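(* Let $t \geq 2$ and let $A,B$ be two families of pseudo-discs in the plane with $|A|=|B|=n$. Let $G=G_{A,B}$ be the bipartite graph with parts $A$ and $B$ in which $a\in A$ and $b\in B$ are adjacent if and only if $a\cap b\neq\emptyset$. If $G$ is $K_{t,t}$-free, then $|E(G)|=O(t^6 n)$, where the implied constant is absolute.
   Context: A family of pseudo-discs is a family of simple closed Jordan regions in the plane such that the boundaries of any two of its members intersect in at most two points. A bipartite graph is $K_{t,t}$-free if it contains no complete bipartite subgraph with $t$ vertices on each side. *)

theory Defs
  imports "HOL-Analysis.Analysis"
begin

definition jordan_region :: "complex set \<Rightarrow> bool" where
  "jordan_region S \<longleftrightarrow>
     (\<exists>\<gamma>. simple_path \<gamma> \<and> pathfinish \<gamma> = pathstart \<gamma> \<and>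
          S = path_image \<gamma> \<union> inside (path_image \<gamma>))"

definition pseudo_discs :: "complex set set \<Rightarrow> bool" where
  "pseudo_discs F \<longleftrightarrow>
     (\<forall>S\<in>F. jordan_region S) \<and>
     (\<forall>S\<in>F. \<forall>T\<in>F. S \<noteq> T \<longrightarrow>
        finite (frontier S \<inter> frontier T) \<and> card (frontier S \<inter> frontier T) \<le> 2)"

text \<open>
  A graph is given by its set of edges, each an unordered pair of vertices. The two parts of the
  intersection graph are the copies \<open>Inl ` A\<close> and \<open>Inr ` B\<close>, so that they are disjoint even if
  some region belongs to both families.
\<close>

definition intersection_edges :: "'a set set \<Rightarrow> 'a set set \<Rightarrow> ('a set + 'a set) set set" where
  "intersection_edges A B = {{Inl a, Inr b} | a b. a \<in> A \<and> b \<in> B \<and> a \<inter> b \<noteq> {}}"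

definition biclique_free :: "nat \<Rightarrow> 'v set set \<Rightarrow> bool" where
  "biclique_free t E \<longleftrightarrow>
     \<not> (\<exists>X Y. finite X \<and> finite Y \<and> card X = t \<and> card Y = t \<and> X \<inter> Y = {} \<and>
              (\<forall>x\<in>X. \<forall>y\<in>Y. {x, y} \<in> E))"

end

theory Submission
  imports Defs "HOL-Complex_Analysis.Winding_Numbers" "HOL-Library.Z2" "HOL-Library.Disjoint_Sets"
begin

text \<open>
  Call two regions of \<open>A\<close> Delaunay neighbours if some member of \<open>B\<close> meets exactly these two. Paths
  through the regions and the connecting members of \<open>B\<close> turn a complete minor \<open>K\<^sub>5\<close> of this graph into
  a drawing of \<open>K\<^sub>5\<close> in which any two independent edges have algebraic intersection number \<open>0\<close>,
  because \<open>D - E\<close> is connected for pseudo-discs \<open>D\<close>, \<open>E\<close> neither of which contains the other. In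
  every drawing of \<open>K\<^sub>5\<close> the sum of these numbers is odd, so the graph has no such minor: it has
  linearly many edges, and the traces of \<open>B\<close> on \<open>A\<close> shatter no five regions.

  Restricting to a random subfamily of \<open>A\<close>, the linear bound shows that regions of \<open>A\<close> that occur
  together in a trace of size \<open>O(t)\<close> form an \<open>O(t)\<close>-degenerate graph. By the Sauer-Shelah lemma there
  are \<open>O(t\<^sup>4 |A|)\<close> traces of size between \<open>t\<close> and \<open>64 t\<close>, and each is shared by at most \<open>t\<close> members
  of \<open>B\<close>. A second sampling reduces members of degree about \<open>k\<close> to this case with \<open>|A|\<close> replaced by
  \<open>O(t |A| / k)\<close>, so the number of members of \<open>B\<close> of degree at least \<open>k\<close> is \<open>O(t\<^sup>6 |A| / k)\<close>. Hence
  the larger side always contains a vertex of degree \<open>O(t\<^sup>6)\<close>, and removing such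
  vertices one by one bounds the number of edges.
\<close>

subsection \<open>Complete minors in dense graphs\<close>

text \<open>Nothing is known about how a boundary from \<open>A\<close> meets a boundary from
  \<open>B\<close>; they may cross without bound. So the Delaunay graph is not drawn without
  crossings. Its drawing is cut into pieces, each inside a single region of \<open>A\<close> or a
  single member of \<open>B\<close>. Two pieces of the same kind are controlled by the pseudo-disc
  property of one family, and pieces of different kinds with disjoint branch sets never meet, since
  a connector misses every region outside its own branch sets. Paths are only continuous and may
  meet infinitely often, so crossings are not counted. A winding number replaces the count; it makes
  sense once the ends of each path avoid the other path, and it is additive under joining. The ends
  must therefore lie in no foreign region. A region may be covered by others, so a
  \<open>K\<^sub>1\<^sub>0\<close> model is sought first and merged in pairs, which is the origin of
  \<open>2 ^ 10\<close>. The exponent 6 is 1 + 4 + 1: members sharing a trace, Sauer-Shelah at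
  dimension 4 on neighbourhoods of size \<open>O(t)\<close>, and the sampling rate
  \<open>16 * t / k\<close>.\<close>

definition conn_in :: "('a \<Rightarrow> 'a \<Rightarrow> bool) \<Rightarrow> 'a set \<Rightarrow> bool" where
  "conn_in E X \<longleftrightarrow> (\<forall>x\<in>X. \<forall>y\<in>X. (x, y) \<in> {(p, q). p \<in> X \<and> q \<in> X \<and> E p q}\<^sup>*)"

definition touch :: "('a \<Rightarrow> 'a \<Rightarrow> bool) \<Rightarrow> 'a set \<Rightarrow> 'a set \<Rightarrow> bool" where
  "touch E X Y \<longleftrightarrow> (\<exists>x\<in>X. \<exists>y\<in>Y. E x y)"

text \<open>Ordered pairs, so the cardinality is a degree sum, and a bound
  \<open>2 ^ r * card P\<close> on it speaks of average degree \<open>2 ^ r\<close>.\<close>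

definition touching_pairs :: "('a \<Rightarrow> 'a \<Rightarrow> bool) \<Rightarrow> 'a set set \<Rightarrow> ('a set \<times> 'a set) set" where
  "touching_pairs E P = {(X, Y). X \<in> P \<and> Y \<in> P \<and> X \<noteq> Y \<and> touch E X Y}"

text \<open>That every branch set contains a whole member of \<open>P\<close> lets the recursion
  extend a model found among the neighbours of a vertex: each branch set then contains a neighbour,
  hence touches the vertex. It also excludes empty branch sets when
  \<open>{} \<notin> P\<close>.\<close>

definition complete_model :: "('a \<Rightarrow> 'a \<Rightarrow> bool) \<Rightarrow> 'a set set \<Rightarrow> nat \<Rightarrow> 'a set set \<Rightarrow> bool" where
  "complete_model E P r Q \<longleftrightarrow> finite Q \<and> card Q = r \<and> disjoint Q \<and> \<Union>Q \<subseteq> \<Union>P \<and>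
    (\<forall>q\<in>Q. conn_in E q \<and> (\<exists>p\<in>P. p \<subseteq> q)) \<and> (\<forall>q\<in>Q. \<forall>q'\<in>Q. q \<noteq> q' \<longrightarrow> touch E q q')"

lemma conn_in_singleton: "conn_in E {x}"
  by (simp add: conn_in_def)

lemma touch_commute: "symp E \<Longrightarrow> touch E X Y \<longleftrightarrow> touch E Y X"
  unfolding touch_def by (meson sympD)

lemma conn_in_Un:
  assumes "symp E" "conn_in E X" "conn_in E Y" "touch E X Y"
  shows "conn_in E (X \<union> Y)"
proof -
  let ?R = "\<lambda>Z. {(p, q). p \<in> Z \<and> q \<in> Z \<and> E p q}"
  obtain x0 y0 where 0: "x0 \<in> X" "y0 \<in> Y" "E x0 y0" "E y0 x0"
    using assms unfolding touch_def by (meson sympD)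
  have mono: "(?R X)\<^sup>* \<subseteq> (?R (X \<union> Y))\<^sup>*" "(?R Y)\<^sup>* \<subseteq> (?R (X \<union> Y))\<^sup>*"
    by (rule rtrancl_mono; auto)+
  have to: "(z, x0) \<in> (?R (X \<union> Y))\<^sup>* \<and> (x0, z) \<in> (?R (X \<union> Y))\<^sup>*" if "z \<in> X \<union> Y" for z
  proof (cases "z \<in> X")
    case True
    then show ?thesis using assms(2) 0 mono unfolding conn_in_def by blast
  next
    case False
    then have "(z, y0) \<in> (?R (X \<union> Y))\<^sup>*" "(y0, z) \<in> (?R (X \<union> Y))\<^sup>*"
      using that assms(3) 0 mono unfolding conn_in_def by blast+
    moreover have "(y0, x0) \<in> ?R (X \<union> Y)" "(x0, y0) \<in> ?R (X \<union> Y)"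
      using 0 by auto
    ultimately show ?thesis
      by (meson rtrancl.rtrancl_into_rtrancl converse_rtrancl_into_rtrancl)
  qed
  show ?thesis
    unfolding conn_in_def using to by (meson rtrancl_trans)
qed

lemma card_touching_pairs_insert:
  assumes "symp E" "finite R" "X \<notin> R"
  shows "card (touching_pairs E (insert X R)) = card (touching_pairs E R) + 2 * card {Z \<in> R. touch E X Z}"
proof -
  let ?N = "{Z \<in> R. touch E X Z}"
  have eq: "touching_pairs E (insert X R) = touching_pairs E R \<union> (Pair X ` ?N \<union> (\<lambda>Z. (Z, X)) ` ?N)"
    using assms touch_commute[OF assms(1)] unfolding touching_pairs_def by auto
  have "finite (touching_pairs E R)"
    by (rule finite_subset[of _ "R \<times> R"]) (auto simp: touching_pairs_def assms)
  moreover have "card (Pair X ` ?N \<union> (\<lambda>Z. (Z, X)) ` ?N) = card ?N + card ?N"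
    using assms by (subst card_Un_disjoint) (auto simp: card_image inj_on_def)
  moreover have "touching_pairs E R \<inter> (Pair X ` ?N \<union> (\<lambda>Z. (Z, X)) ` ?N) = {}"
    using assms by (auto simp: touching_pairs_def)
  ultimately show ?thesis
    unfolding eq using assms by (subst card_Un_disjoint) auto
qed

text \<open>Contraction loses the edge between \<open>X\<close> and \<open>Y\<close> and identifies
  the two edges that lead to each common neighbour; both losses count twice because pairs are
  ordered.\<close>

lemma card_touching_pairs_contract:
  assumes "symp E" "finite R" "X \<notin> R" "Y \<notin> R" "X \<noteq> Y" "X \<union> Y \<notin> R" "touch E X Y"
  shows "card (touching_pairs E (insert X (insert Y R))) =
    card (touching_pairs E (insert (X \<union> Y) R)) + 2 + 2 * card {Z \<in> R. touch E X Z \<and> touch E Y Z}"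
proof -
  let ?NX = "{Z \<in> R. touch E X Z}" and ?NY = "{Z \<in> R. touch E Y Z}"
  have "{Z \<in> insert Y R. touch E X Z} = insert Y ?NX"
    using assms by auto
  then have "card {Z \<in> insert Y R. touch E X Z} = Suc (card ?NX)"
    using assms by simp
  moreover have "{Z \<in> R. touch E (X \<union> Y) Z} = ?NX \<union> ?NY"
    by (auto simp: touch_def)
  moreover have "{Z \<in> R. touch E X Z \<and> touch E Y Z} = ?NX \<inter> ?NY"
    by auto
  moreover have "card ?NX + card ?NY = card (?NX \<union> ?NY) + card (?NX \<inter> ?NY)"
    using assms by (intro card_Un_Int) auto
  ultimately show ?thesis
    using assms by (simp add: card_touching_pairs_insert)
qed

text \<open>Mader's argument: contract an edge with few common neighbours; if there is none, every
  neighbourhood is dense and contains a smaller complete minor, to which the vertex itself is added.\<close>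

lemma complete_minor:
  assumes "symp E" "finite P" "P \<noteq> {}" "{} \<notin> P" "disjoint P" "\<And>X. X \<in> P \<Longrightarrow> conn_in E X"
    "2 ^ r * card P \<le> card (touching_pairs E P)"
  shows "\<exists>Q. complete_model E P r Q"
  using assms(2-)
proof (induction r arbitrary: P)
  case 0
  then show ?case by (intro exI[of _ "{}"]) (auto simp: complete_model_def)
next
  case (Suc r)
  note IH_r = Suc.IH
  show ?case
    using Suc.prems
  \<comment> \<open>Contraction keeps \<open>r\<close> and shrinks \<open>P\<close>; passing to a
    neighbourhood lowers \<open>r\<close>. Hence an induction on \<open>card P\<close> inside the
    one on \<open>r\<close>.\<close>
  proof (induction "card P" arbitrary: P rule: less_induct)
    case less
    have disj: "X \<inter> Y = {}" if "X \<in> P" "Y \<in> P" "X \<noteq> Y" for X Y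
      using that less.prems(4) by (auto simp: disjoint_def)
    show ?case
    proof (cases "\<exists>X\<in>P. \<exists>Y\<in>P. X \<noteq> Y \<and> touch E X Y \<and> card {Z \<in> P - {X, Y}. touch E X Z \<and> touch E Y Z} < 2 ^ r")
      case True
      then obtain X Y where XY: "X \<in> P" "Y \<in> P" "X \<noteq> Y" "touch E X Y"
        "card {Z \<in> P - {X, Y}. touch E X Z \<and> touch E Y Z} < 2 ^ r"
        by blast
      define R where "R = P - {X, Y}"
      have P: "P = insert X (insert Y R)"
        using XY by (auto simp: R_def)
      have nR: "X \<notin> R" "Y \<notin> R" "X \<union> Y \<notin> R"
        using disj[OF _ XY(1), of "X \<union> Y"] XY less.prems(3) by (auto simp: R_def)
      have finR: "finite R"
        using less.prems(1) by (simp add: R_def)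
      define P' where "P' = insert (X \<union> Y) R"
      have cP: "card P = Suc (card P')"
        using XY nR finR by (simp add: P P'_def)
      have "card (touching_pairs E P) = card (touching_pairs E P') + 2 + 2 * card {Z \<in> R. touch E X Z \<and> touch E Y Z}"
        unfolding P P'_def using assms(1) finR nR XY by (intro card_touching_pairs_contract) auto
      \<comment> \<open>The contraction thus costs at most \<open>2 * 2 ^ r\<close> pairs, exactly
        what the density condition for \<open>Suc r\<close> concedes for one vertex less.\<close>
      moreover have "1 + card {Z \<in> R. touch E X Z \<and> touch E Y Z} \<le> 2 ^ r"
        using XY(5) by (simp add: R_def)
      ultimately have dense: "2 ^ Suc r * card P' \<le> card (touching_pairs E P')"
        using less.prems(6) by (simp add: cP)
      have P': "card P' < card P" "finite P'" "P' \<noteq> {}" "{} \<notin> P'"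
        using cP finR less.prems(3) XY by (auto simp: P'_def R_def)
      have disjP': "disjoint P'"
        using disj XY unfolding P'_def R_def disjoint_def by blast
      have connP': "conn_in E Z" if "Z \<in> P'" for Z
        using that less.prems(5) XY conn_in_Un[OF assms(1)] by (auto simp: P'_def R_def)
      have "\<exists>Q. complete_model E P' (Suc r) Q"
        by (rule less.hyps) (fact P' disjP' connP' dense)+
      then obtain Q where Q: "complete_model E P' (Suc r) Q" ..
      have "\<exists>p\<in>P. p \<subseteq> q" if "q \<in> Q" for q
      proof -
        have "\<exists>p\<in>P'. p \<subseteq> q"
          using Q that by (simp add: complete_model_def)
        then obtain p where "p \<in> P'" "p \<subseteq> q" ..
        then show ?thesis
          using XY by (cases "p = X \<union> Y") (auto simp: P'_def R_def)
      qed
      moreover have "\<Union>P' \<subseteq> \<Union>P"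
        using XY by (auto simp: P'_def R_def)
      ultimately have "complete_model E P (Suc r) Q"
        using Q order_trans[of "\<Union>Q" "\<Union>P'" "\<Union>P"] by (simp add: complete_model_def)
      then show ?thesis ..
    next
      case False
      have "touching_pairs E P \<noteq> {}"
        using less.prems(1,2,6) by (metis card.empty card_0_eq le_zero_eq mult_is_0 power_not_zero zero_neq_numeral)
      then obtain X Y0 where X: "X \<in> P" "Y0 \<in> P" "X \<noteq> Y0" "touch E X Y0"
        by (auto simp: touching_pairs_def)
      define N where "N = {Y \<in> P. X \<noteq> Y \<and> touch E X Y}"
      have finN: "finite N"
        using less.prems(1) by (simp add: N_def)
      have "touching_pairs E N = Sigma N (\<lambda>Y. {Z \<in> P - {X, Y}. touch E X Z \<and> touch E Y Z})"
        by (auto simp: touching_pairs_def N_def)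
      then have "card (touching_pairs E N) = (\<Sum>Y\<in>N. card {Z \<in> P - {X, Y}. touch E X Z \<and> touch E Y Z})"
        using finN less.prems(1) by simp
      also have "\<dots> \<ge> (\<Sum>Y\<in>N. 2 ^ r)"
        using False X by (intro sum_mono) (auto simp: N_def not_less)
      finally have denseN: "2 ^ r * card N \<le> card (touching_pairs E N)"
        by (simp add: mult.commute)
      have N: "N \<noteq> {}" "{} \<notin> N" "disjoint N" "\<And>Z. Z \<in> N \<Longrightarrow> conn_in E Z"
        using X less.prems by (auto simp: N_def disjoint_def)
      have "\<exists>Q. complete_model E N r Q"
        by (rule IH_r) (fact finN N denseN)+
      then obtain Q where "complete_model E N r Q" ..
      then have Q: "finite Q" "card Q = r" "disjoint Q" "\<Union>Q \<subseteq> \<Union>N"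
        "\<forall>q\<in>Q. conn_in E q \<and> (\<exists>p\<in>N. p \<subseteq> q)" "\<forall>q\<in>Q. \<forall>q'\<in>Q. q \<noteq> q' \<longrightarrow> touch E q q'"
        by (simp_all add: complete_model_def)
      have X_disj: "X \<inter> \<Union>N = {}"
        using disj X(1) by (auto simp: N_def)
      have "X \<noteq> {}"
        using X less.prems by blast
      then have "X \<notin> Q"
        using X_disj Q(4) by blast
      moreover have "touch E X q" "touch E q X" if q: "q \<in> Q" for q
      proof -
        obtain p where "p \<in> N" "p \<subseteq> q"
          using Q(5) q by blast
        then show "touch E X q"
          unfolding N_def touch_def by blast
        then show "touch E q X"
          using touch_commute[OF assms(1)] by blast
      qed
      moreover have "disjoint (insert X Q)"
        using Q(3,4) X_disj unfolding disjoint_def by blast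
      moreover have "\<Union>(insert X Q) \<subseteq> \<Union>P"
        using Q(4) X(1) by (auto simp: N_def)
      moreover have "\<exists>p\<in>P. p \<subseteq> q" if "q \<in> insert X Q" for q
        using that Q(5) X(1) by (auto simp: N_def)
      ultimately show ?thesis
        using Q less.prems(5) X(1) by (intro exI[of _ "insert X Q"]) (auto simp: complete_model_def)
    qed
  qed
qed

subsection \<open>Shattering\<close>

definition shatters :: "'a set set \<Rightarrow> 'a set \<Rightarrow> bool" where
  "shatters F X \<longleftrightarrow> (\<forall>Y\<subseteq>X. \<exists>S\<in>F. S \<inter> X = Y)"

lemma shattersD: "shatters F X \<Longrightarrow> Y \<subseteq> X \<Longrightarrow> \<exists>S\<in>F. S \<inter> X = Y"
  by (simp add: shatters_def)

lemma shatters_mono: "F \<subseteq> G \<Longrightarrow> shatters F X \<Longrightarrow> shatters G X"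
  unfolding shatters_def by (meson subsetD)

lemma shatters_subset:
  assumes "shatters F X" "Y \<subseteq> X"
  shows "shatters F Y"
  unfolding shatters_def
proof (intro allI impI)
  fix Z assume "Z \<subseteq> Y"
  have "\<exists>S\<in>F. S \<inter> X = Z"
    using assms \<open>Z \<subseteq> Y\<close> by (intro shattersD) auto
  then obtain S where "S \<in> F" "S \<inter> X = Z" ..
  then show "\<exists>S\<in>F. S \<inter> Y = Z"
    using assms(2) \<open>Z \<subseteq> Y\<close> by (intro bexI[of _ S]) auto
qed

text \<open>Pajor's form of the Sauer-Shelah lemma, which has a clean induction. Split
  \<open>F\<close> by membership of \<open>x\<close> and delete \<open>x\<close> from the second
  half: a set shattered by both halves is shattered by \<open>F\<close> with and without
  \<open>x\<close>.\<close>

lemma card_le_card_shattered: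
  assumes "finite V" "F \<subseteq> Pow V"
  shows "card F \<le> card {X. X \<subseteq> V \<and> shatters F X}"
  using assms
proof (induction V arbitrary: F rule: finite_induct)
  case empty
  then have "F = {} \<or> F = {{}}"
    by auto
  then show ?case
  proof
    assume F: "F = {{}}"
    have single: "{X. X \<subseteq> {} \<and> shatters {{}} X} = {{}}"
      by (auto simp: shatters_def)
    show ?case
      unfolding F single by simp
  qed simp
next
  case (insert x V)
  define F1 where "F1 = {S \<in> F. x \<notin> S}"
  define F2' where "F2' = {S \<in> F. x \<in> S}"
  define F2 where "F2 = (\<lambda>S. S - {x}) ` F2'"
  let ?G = "\<lambda>F. {X. X \<subseteq> V \<and> shatters F X}"
  have F: "F = F1 \<union> F2'" "F1 \<inter> F2' = {}"
    by (auto simp: F1_def F2'_def)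
  have finF: "finite F"
    using insert.prems insert.hyps finite_subset[of F "Pow (insert x V)"] by simp
  have "inj_on (\<lambda>S. S - {x}) F2'"
    unfolding inj_on_def F2'_def by (metis (mono_tags, lifting) insert_Diff mem_Collect_eq)
  then have "card F2' = card F2"
    by (simp add: F2_def card_image)
  moreover have "card F = card F1 + card F2'"
    using F finF by (metis card_Un_disjoint finite_Un)
  ultimately have "card F = card F1 + card F2"
    by simp
  also have "\<dots> \<le> card (?G F1) + card (?G F2)"
    using insert.prems by (intro add_mono insert.IH) (auto simp: F1_def F2_def F2'_def)
  also have "\<dots> = card (?G F1 \<union> ?G F2) + card (?G F1 \<inter> ?G F2)"
    using insert.hyps by (intro card_Un_Int) auto
  \<comment> \<open>The sets counted twice are represented the second time by adding
    \<open>x\<close>, which keeps them apart from the subsets of \<open>V\<close>.\<close>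
  also have "card (?G F1 \<inter> ?G F2) = card (insert x ` (?G F1 \<inter> ?G F2))"
  proof (rule card_image[symmetric])
    show "inj_on (insert x) (?G F1 \<inter> ?G F2)"
      unfolding inj_on_def
    proof (intro ballI impI)
      fix X Y assume "X \<in> ?G F1 \<inter> ?G F2" "Y \<in> ?G F1 \<inter> ?G F2" "insert x X = insert x Y"
      moreover have "x \<notin> X" "x \<notin> Y"
        using calculation(1,2) insert.hyps(2) by auto
      ultimately show "X = Y"
        by (metis Diff_insert_absorb)
    qed
  qed
  also have "card (?G F1 \<union> ?G F2) + \<dots> = card ((?G F1 \<union> ?G F2) \<union> insert x ` (?G F1 \<inter> ?G F2))"
    using insert.hyps by (intro card_Un_disjoint[symmetric]) auto
  also have "\<dots> \<le> card {X. X \<subseteq> insert x V \<and> shatters F X}"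
  proof (rule card_mono)
    show "finite {X. X \<subseteq> insert x V \<and> shatters F X}"
      using insert.hyps by simp
    have 1: "shatters F X" if "X \<in> ?G F1" for X
      using that shatters_mono[of F1 F X] by (auto simp: F1_def)
    have 2: "shatters F X" if X: "X \<in> ?G F2" for X
      unfolding shatters_def
    proof (intro allI impI)
      fix Y assume "Y \<subseteq> X"
      then have "\<exists>T\<in>F2. T \<inter> X = Y"
        using X by (intro shattersD) auto
      then obtain T where T: "T \<in> F2" "T \<inter> X = Y" ..
      then obtain S where S: "S \<in> F2'" "(S - {x}) \<inter> X = Y"
        unfolding F2_def by auto
      have "x \<notin> X"
        using X insert.hyps by auto
      then have "S \<inter> X = Y" "S \<in> F"
        using S by (auto simp: F2'_def)
      then show "\<exists>S\<in>F. S \<inter> X = Y" by auto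
    qed
    have 3: "shatters F (insert x X)" if X: "X \<in> ?G F1 \<inter> ?G F2" for X
      unfolding shatters_def
    proof (intro allI impI)
      fix Y assume Y: "Y \<subseteq> insert x X"
      have xX: "x \<notin> X"
        using X insert.hyps by auto
      show "\<exists>S\<in>F. S \<inter> insert x X = Y"
      proof (cases "x \<in> Y")
        case True
        have "Y - {x} \<subseteq> X"
          using Y by auto
        then have "\<exists>T\<in>F2. T \<inter> X = Y - {x}"
          using X by (intro shattersD) auto
        then obtain T where T: "T \<in> F2" "T \<inter> X = Y - {x}" ..
        then obtain S where S: "S \<in> F2'" "(S - {x}) \<inter> X = Y - {x}"
          unfolding F2_def by auto
        then have "S \<inter> insert x X = Y"
          using True xX unfolding F2'_def by auto
        then show ?thesis
          using S by (auto simp: F2'_def)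
      next
        case False
        then have "Y \<subseteq> X"
          using Y by auto
        then have "\<exists>S\<in>F1. S \<inter> X = Y"
          using X by (intro shattersD) auto
        then obtain S where S: "S \<in> F1" "S \<inter> X = Y" ..
        then have "S \<inter> insert x X = Y"
          unfolding F1_def by auto
        then show ?thesis
          using S by (auto simp: F1_def)
      qed
    qed
    show "?G F1 \<union> ?G F2 \<union> insert x ` (?G F1 \<inter> ?G F2) \<subseteq> {X. X \<subseteq> insert x V \<and> shatters F X}"
    proof
      fix X assume "X \<in> ?G F1 \<union> ?G F2 \<union> insert x ` (?G F1 \<inter> ?G F2)"
      then show "X \<in> {X. X \<subseteq> insert x V \<and> shatters F X}"
        using 1 2 3 by (elim UnE imageE) auto
    qed
  qed
  finally show ?case .
qed

lemma card_small_subsets: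
  assumes "finite V"
  shows "card {X. X \<subseteq> V \<and> card X \<le> d} \<le> (card V + 1) ^ d"
proof (induction d)
  case 0
  have "{X. X \<subseteq> V \<and> card X \<le> 0} = {{}}"
    using assms by (auto dest: finite_subset)
  then show ?case by simp
next
  case (Suc d)
  let ?S = "{X. X \<subseteq> V \<and> card X \<le> d}"
  have finS: "finite ?S"
    using assms by simp
  have "{X. X \<subseteq> V \<and> card X \<le> Suc d} \<subseteq> ?S \<union> (\<lambda>(X, y). insert y X) ` (?S \<times> V)"
  proof
    fix X assume X: "X \<in> {X. X \<subseteq> V \<and> card X \<le> Suc d}"
    show "X \<in> ?S \<union> (\<lambda>(X, y). insert y X) ` (?S \<times> V)"
    proof (cases "X = {}")
      case True
      then show ?thesis by simp
    next
      case False
      then obtain y where y: "y \<in> X" by auto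
      have "finite X"
        using X assms finite_subset by auto
      then have "card (X - {y}) \<le> d"
        using X y by auto
      then have "(X - {y}, y) \<in> ?S \<times> V"
        using X y by auto
      moreover have "X = (\<lambda>(X, y). insert y X) (X - {y}, y)"
        using y by auto
      ultimately show ?thesis by blast
    qed
  qed
  then have "card {X. X \<subseteq> V \<and> card X \<le> Suc d} \<le> card (?S \<union> (\<lambda>(X, y). insert y X) ` (?S \<times> V))"
    using finS assms by (intro card_mono) auto
  also have "\<dots> \<le> card ?S + card (?S \<times> V)"
    using finS assms by (intro order_trans[OF card_Un_le] add_mono card_image_le) auto
  also have "\<dots> = card ?S * (card V + 1)"
    by (simp add: card_cartesian_product)
  also have "\<dots> \<le> (card V + 1) ^ d * (card V + 1)"
    using Suc.IH by (intro mult_right_mono) auto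
  finally show ?case
    by (simp add: mult.commute)
qed

lemma sauer_shelah:
  assumes "finite V" "F \<subseteq> Pow V" "\<And>X. \<lbrakk>X \<subseteq> V; card X = Suc d\<rbrakk> \<Longrightarrow> \<not> shatters F X"
  shows "card F \<le> (card V + 1) ^ d"
proof -
  have "{X. X \<subseteq> V \<and> shatters F X} \<subseteq> {X. X \<subseteq> V \<and> card X \<le> d}"
  proof
    fix X assume X: "X \<in> {X. X \<subseteq> V \<and> shatters F X}"
    show "X \<in> {X. X \<subseteq> V \<and> card X \<le> d}"
    proof (rule ccontr)
      assume "X \<notin> {X. X \<subseteq> V \<and> card X \<le> d}"
      then have "Suc d \<le> card X"
        using X by auto
      then obtain Y where "Y \<subseteq> X" "card Y = Suc d"
        using obtain_subset_with_card_n by metis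
      then show False
        using X assms(3)[of Y] shatters_subset[of F X Y] by auto
    qed
  qed
  then have "card {X. X \<subseteq> V \<and> shatters F X} \<le> card {X. X \<subseteq> V \<and> card X \<le> d}"
    using assms(1) by (intro card_mono) auto
  then show ?thesis
    using card_le_card_shattered[OF assms(1,2)] card_small_subsets[OF assms(1), of d] by linarith
qed

subsection \<open>Random subsets\<close>

text \<open>Expectation over the random subset of \<open>A\<close> that contains each element independently with
  probability \<open>p\<close>.\<close>

definition rexp :: "real \<Rightarrow> 'a set \<Rightarrow> ('a set \<Rightarrow> real) \<Rightarrow> real" where
  "rexp p A g = (\<Sum>S\<in>Pow A. p ^ card S * (1 - p) ^ card (A - S) * g S)"

lemma rexp_cong: "(\<And>S. S \<subseteq> A \<Longrightarrow> g S = h S) \<Longrightarrow> rexp p A g = rexp p A h"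
  unfolding rexp_def by (intro sum.cong) auto

lemma rexp_mono:
  assumes "0 \<le> p" "p \<le> 1" "\<And>S. S \<subseteq> A \<Longrightarrow> g S \<le> h S"
  shows "rexp p A g \<le> rexp p A h"
  unfolding rexp_def using assms by (intro sum_mono mult_left_mono) auto

lemma rexp_cmult: "rexp p A (\<lambda>S. c * g S) = c * rexp p A g"
  unfolding rexp_def sum_distrib_left by (intro sum.cong) auto

lemma rexp_add: "rexp p A (\<lambda>S. g S + h S) = rexp p A g + rexp p A h"
  unfolding rexp_def by (simp add: distrib_left sum.distrib)

lemma rexp_sum: "rexp p A (\<lambda>S. \<Sum>i\<in>I. g i S) = (\<Sum>i\<in>I. rexp p A (g i))"
  unfolding rexp_def sum_distrib_left by (rule sum.swap)

lemma rexp_insert: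
  assumes "finite A" "x \<notin> A"
  shows "rexp p (insert x A) g = (1 - p) * rexp p A g + p * rexp p A (\<lambda>S. g (insert x S))"
proof -
  let ?w = "\<lambda>S. p ^ card S * (1 - p) ^ card (insert x A - S) * g S"
  have "rexp p (insert x A) g = (\<Sum>S\<in>Pow A. ?w S) + (\<Sum>S\<in>insert x ` Pow A. ?w S)"
    unfolding rexp_def Pow_insert using assms by (intro sum.union_disjoint) auto
  also have "(\<Sum>S\<in>insert x ` Pow A. ?w S) = (\<Sum>S\<in>Pow A. ?w (insert x S))"
  proof -
    have "inj_on (insert x) (Pow A)"
      unfolding inj_on_def using assms(2) by (metis Diff_insert_absorb PowD subsetD)
    then show ?thesis
      by (simp add: sum.reindex)
  qed
  also have "\<dots> = p * rexp p A (\<lambda>S. g (insert x S))"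
    unfolding rexp_def sum_distrib_left
  proof (rule sum.cong[OF refl])
    fix S assume "S \<in> Pow A"
    then have "x \<notin> S" "finite S" "insert x A - insert x S = A - S"
      using assms by (auto dest: finite_subset)
    then show "?w (insert x S) = p * (p ^ card S * (1 - p) ^ card (A - S) * g (insert x S))"
      by simp
  qed
  also have "(\<Sum>S\<in>Pow A. ?w S) = (1 - p) * rexp p A g"
    unfolding rexp_def sum_distrib_left
  proof (rule sum.cong[OF refl])
    fix S assume "S \<in> Pow A"
    then have "insert x A - S = insert x (A - S)" "x \<notin> A - S" "finite (A - S)"
      using assms by auto
    then show "?w S = (1 - p) * (p ^ card S * (1 - p) ^ card (A - S) * g S)"
      by simp
  qed
  finally show ?thesis by simp
qed

lemma rexp_const: "finite A \<Longrightarrow> rexp p A (\<lambda>S. c) = c"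
  by (induction A rule: finite_induct) (simp_all add: rexp_insert algebra_simps, simp add: rexp_def)

text \<open>The trace on \<open>M\<close> of a random subset of \<open>A\<close> is a random subset
  of \<open>M\<close> with the same \<open>p\<close>: elements outside \<open>M\<close> are averaged
  out one at a time.\<close>

lemma rexp_inter:
  assumes "finite A" "M \<subseteq> A"
  shows "rexp p A (\<lambda>S. g (S \<inter> M)) = rexp p M g"
proof -
  have "finite M"
    using assms finite_subset by auto
  have "rexp p (M \<union> D) (\<lambda>S. g (S \<inter> M)) = rexp p M g" if "finite D" "D \<inter> M = {}" for D
    using that
  proof (induction D rule: finite_induct)
    case empty
    then show ?case by (auto intro: rexp_cong simp: Int_absorb2)
  next
    case (insert x D)
    then have "insert x S \<inter> M = S \<inter> M" for S
      by auto
    moreover have "x \<notin> M \<union> D"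
      using insert by auto
    ultimately show ?case
      using insert \<open>finite M\<close> by (simp add: rexp_insert algebra_simps)
  qed
  from this[of "A - M"] show ?thesis
    using assms by (simp add: Un_absorb1 Int_commute)
qed

lemma rexp_indicator:
  assumes "finite M" "T \<subseteq> M"
  shows "rexp p M (\<lambda>S. of_bool (S = T)) = p ^ card T * (1 - p) ^ card (M - T)"
proof -
  have "rexp p M (\<lambda>S. of_bool (S = T)) = (\<Sum>S\<in>Pow M. if S = T then p ^ card T * (1 - p) ^ card (M - T) else 0)"
    unfolding rexp_def by (intro sum.cong) auto
  then show ?thesis
    using assms by simp
qed

lemma rexp_card:
  assumes "finite A"
  shows "rexp p A (\<lambda>S. real (card S)) = p * card A"
  using assms
proof (induction A rule: finite_induct)
  case empty
  then show ?case by (simp add: rexp_def)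
next
  case (insert x A)
  have "rexp p A (\<lambda>S. real (card (insert x S))) = rexp p A (\<lambda>S. real (card S) + 1)"
  proof (rule rexp_cong)
    fix S assume "S \<subseteq> A"
    then show "real (card (insert x S)) = real (card S) + 1"
      using insert.hyps finite_subset[of S A] by (subst card_insert_disjoint) auto
  qed
  also have "\<dots> = p * card A + 1"
    using insert by (simp add: rexp_add rexp_const)
  finally show ?case
    using insert by (simp add: rexp_insert algebra_simps)
qed

text \<open>Variance plus squared bias. The centre \<open>c\<close> is arbitrary because including
  the new element shifts it to \<open>c - 1\<close> in the induction.\<close>

lemma rexp_square:
  assumes "finite A"
  shows "rexp p A (\<lambda>S. (real (card S) - c)\<^sup>2) = p * (1 - p) * card A + (p * card A - c)\<^sup>2"
  using assms
proof (induction A arbitrary: c rule: finite_induct)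
  case empty
  then show ?case by (simp add: rexp_def)
next
  case (insert x A)
  have "rexp p A (\<lambda>S. (real (card (insert x S)) - c)\<^sup>2) = rexp p A (\<lambda>S. (real (card S) - (c - 1))\<^sup>2)"
  proof (rule rexp_cong)
    fix S assume "S \<subseteq> A"
    then have "real (card (insert x S)) = real (card S) + 1"
      using insert.hyps finite_subset[of S A] by (subst card_insert_disjoint) auto
    then show "(real (card (insert x S)) - c)\<^sup>2 = (real (card S) - (c - 1))\<^sup>2"
      by (simp add: algebra_simps)
  qed
  then have "rexp p (insert x A) (\<lambda>S. (real (card S) - c)\<^sup>2) =
      (1 - p) * (p * (1 - p) * card A + (p * card A - c)\<^sup>2)
      + p * (p * (1 - p) * card A + (p * card A - (c - 1))\<^sup>2)"
    by (simp only: rexp_insert[OF insert.hyps] insert.IH)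
  also have "\<dots> = p * (1 - p) * (real (card A) + 1) + (p * (real (card A) + 1) - c)\<^sup>2"
    by (simp add: power2_eq_square algebra_simps)
  finally show ?case
    using insert by (simp add: add.commute)
qed

subsection \<open>Members of large degree\<close>

text \<open>The counting is done for an abstract set system. When \<open>N b\<close> is the set of
  regions that meet \<open>b\<close>, these are the Delaunay edges on \<open>S\<close>, and the
  linear bound enters through them.\<close>

definition exact_pairs :: "'b set \<Rightarrow> ('b \<Rightarrow> 'a set) \<Rightarrow> 'a set \<Rightarrow> ('a \<times> 'a) set" where
  "exact_pairs B N S = {(a, a'). a \<noteq> a' \<and> (\<exists>b\<in>B. N b \<inter> S = {a, a'})}"

definition shallow_pairs :: "'b set \<Rightarrow> ('b \<Rightarrow> 'a set) \<Rightarrow> nat \<Rightarrow> 'a set \<Rightarrow> ('a \<times> 'a) set" where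
  "shallow_pairs B N k S = {(a, a'). a \<noteq> a' \<and> (\<exists>b\<in>B. {a, a'} \<subseteq> N b \<inter> S \<and> card (N b \<inter> S) \<le> k)}"

text \<open>The Clarkson-Shor argument. With \<open>p = 1 / (2 * k)\<close> a shallow pair becomes
  exact in the sample with probability at least \<open>p\<^sup>2 / 2\<close>: both elements are
  chosen and the at most \<open>k\<close> others of the trace are not. The expected number of exact
  pairs is at most \<open>c * p * card A\<close>.\<close>

lemma card_shallow_pairs:
  assumes "finite A" "k \<ge> 1"
    and lin: "\<And>S. S \<subseteq> A \<Longrightarrow> card (exact_pairs B N S) \<le> c * card S"
  shows "card (shallow_pairs B N k A) \<le> 4 * c * k * card A"
proof -
  define p where "p = 1 / (2 * real k)"
  have p: "0 < p" "p \<le> 1"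
    using assms(2) by (auto simp: p_def field_simps)
  let ?G = "shallow_pairs B N k A"
  have finG: "finite ?G"
    by (rule finite_subset[of _ "A \<times> A"]) (use assms(1) in \<open>auto simp: shallow_pairs_def\<close>)
  have fin_exact: "finite (exact_pairs B N S)" if "S \<subseteq> A" for S
  proof (rule finite_subset)
    show "exact_pairs B N S \<subseteq> S \<times> S"
      by (auto simp: exact_pairs_def)
    show "finite (S \<times> S)"
      using that assms(1) finite_subset by auto
  qed
  have prob: "p\<^sup>2 / 2 \<le> rexp p A (\<lambda>S. of_bool (g \<in> exact_pairs B N S))" if g: "g \<in> ?G" for g
  proof -
    obtain a a' b where g_eq: "g = (a, a')" "a \<noteq> a'" and b: "b \<in> B" "{a, a'} \<subseteq> N b \<inter> A" "card (N b \<inter> A) \<le> k"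
      using g by (auto simp: shallow_pairs_def)
    define M where "M = N b \<inter> A"
    have M: "finite M" "M \<subseteq> A" "{a, a'} \<subseteq> M"
      using b assms(1) by (auto simp: M_def)
    have "card (M - {a, a'}) \<le> card M"
      using M(1) by (intro card_mono) auto
    then have "card (M - {a, a'}) \<le> k"
      using b(3) by (simp add: M_def)
    then have "1 / 2 \<le> 1 + real (card (M - {a, a'})) * (- p)"
      using assms(2) by (simp add: p_def field_simps)
    \<comment> \<open>By Bernoulli's inequality, sampling at rate \<open>1 / (2 * k)\<close> misses
      up to \<open>k\<close> elements with probability at least one half.\<close>
    also have "\<dots> \<le> (1 + - p) ^ card (M - {a, a'})"
      using p by (intro Bernoulli_inequality) auto
    finally have "p\<^sup>2 / 2 \<le> p\<^sup>2 * (1 - p) ^ card (M - {a, a'})"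
      using mult_left_mono[of "1/2" "(1 - p) ^ card (M - {a, a'})" "p\<^sup>2"] by simp
    also have "\<dots> = rexp p M (\<lambda>S. of_bool (S = {a, a'}))"
      using rexp_indicator[OF M(1,3)] g_eq(2) by (simp add: power2_eq_square)
    also have "\<dots> = rexp p A (\<lambda>S. of_bool (S \<inter> M = {a, a'}))"
      by (rule rexp_inter[OF assms(1) M(2), symmetric])
    also have "\<dots> \<le> rexp p A (\<lambda>S. of_bool (g \<in> exact_pairs B N S))"
    proof (rule rexp_mono)
      fix S assume "S \<subseteq> A"
      then have "S \<inter> M = N b \<inter> S"
        by (auto simp: M_def)
      then show "(of_bool (S \<inter> M = {a, a'}) :: real) \<le> of_bool (g \<in> exact_pairs B N S)"
        using b(1) g_eq by (auto simp: exact_pairs_def)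
    qed (use p in auto)
    finally show ?thesis .
  qed
  have "card ?G * (p\<^sup>2 / 2) \<le> (\<Sum>g\<in>?G. rexp p A (\<lambda>S. of_bool (g \<in> exact_pairs B N S)))"
    using sum_mono[of ?G "\<lambda>_. p\<^sup>2 / 2", OF prob] by simp
  also have "\<dots> = rexp p A (\<lambda>S. \<Sum>g\<in>?G. of_bool (g \<in> exact_pairs B N S))"
    by (rule rexp_sum[symmetric])
  also have "\<dots> \<le> rexp p A (\<lambda>S. real c * real (card S))"
  proof (rule rexp_mono)
    fix S assume S: "S \<subseteq> A"
    have "(\<Sum>g\<in>?G. of_bool (g \<in> exact_pairs B N S)) = real (card (?G \<inter> exact_pairs B N S))"
      using finG by (simp add: Int_def of_bool_def flip: sum.inter_filter)
    also have "\<dots> \<le> real (card (exact_pairs B N S))"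
      using fin_exact[OF S] by (simp add: card_mono)
    also have "\<dots> \<le> real (c * card S)"
      using lin[OF S] by (simp only: of_nat_le_iff)
    finally show "(\<Sum>g\<in>?G. of_bool (g \<in> exact_pairs B N S)) \<le> real c * real (card S)"
      by simp
  qed (use p in auto)
  also have "\<dots> = c * p * card A"
    using assms(1) by (simp add: rexp_cmult rexp_card)
  finally have "card ?G * p \<le> 2 * c * card A"
    using p(1) by (simp add: power2_eq_square field_simps)
  then have "real (card ?G) \<le> real (4 * c * k * card A)"
    using assms(2) by (simp add: p_def field_simps)
  then show ?thesis
    by (simp only: of_nat_le_iff)
qed

lemma exists_low_degree:
  assumes "finite A" "A \<noteq> {}" "G \<subseteq> A \<times> A" "card G \<le> d * card A"
  shows "\<exists>v\<in>A. card {a. (v, a) \<in> G} \<le> d"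
proof (rule ccontr)
  assume "\<not> ?thesis"
  then have "(\<Sum>v\<in>A. Suc d) \<le> (\<Sum>v\<in>A. card {a. (v, a) \<in> G})"
    by (intro sum_mono) (simp add: not_le Suc_leI)
  also have "\<dots> = card (Sigma A (\<lambda>v. {a. (v, a) \<in> G}))"
  proof (rule card_SigmaI[symmetric])
    show "\<forall>v\<in>A. finite {a. (v, a) \<in> G}"
      using assms(1,3) by (auto intro: finite_subset[of _ A])
  qed fact
  also have "Sigma A (\<lambda>v. {a. (v, a) \<in> G}) = G"
    using assms(3) by auto
  finally have "card A * Suc d \<le> card G"
    by simp
  then have "card A * Suc d \<le> card A * d"
    using assms(4) by (simp add: mult.commute)
  moreover have "card A > 0"
    using assms by (simp add: card_gt_0_iff)
  ultimately show False
    by simp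
qed

lemma card_le_fibres:
  assumes "finite X" "\<And>y. y \<in> f ` X \<Longrightarrow> card {x \<in> X. f x = y} \<le> m"
  shows "card X \<le> m * card (f ` X)"
proof -
  have "card X = card (\<Union>y\<in>f ` X. {x \<in> X. f x = y})"
    by (rule arg_cong[where f = card]) auto
  also have "\<dots> \<le> (\<Sum>y\<in>f ` X. card {x \<in> X. f x = y})"
    using assms(1) by (intro card_UN_le) simp
  also have "\<dots> \<le> (\<Sum>y\<in>f ` X. m)"
    using assms(2) by (rule sum_mono)
  finally show ?thesis
    by (simp add: mult.commute)
qed

text \<open>Remove a vertex \<open>v\<close> of degree at most \<open>4 * c * k\<close> in the
  shallow graph. Any trace through \<open>v\<close> of size at most \<open>k\<close> lies in
  \<open>v\<close> and its shallow neighbours, so Sauer-Shelah bounds the number of such traces. A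
  trace of size at least \<open>t\<close> contains a \<open>t\<close>-set, so it belongs to at most
  \<open>t\<close> members.\<close>

lemma card_shallow_members:
  assumes "finite A" "finite B" "k \<ge> 1"
    and lin: "\<And>S. S \<subseteq> A \<Longrightarrow> card (exact_pairs B N S) \<le> c * card S"
    and vc: "\<And>X. \<lbrakk>X \<subseteq> A; card X = 5\<rbrakk> \<Longrightarrow> \<exists>Y\<subseteq>X. \<forall>b\<in>B. N b \<inter> X \<noteq> Y"
    and mult: "\<And>X. \<lbrakk>X \<subseteq> A; card X = t\<rbrakk> \<Longrightarrow> card {b \<in> B. X \<subseteq> N b} \<le> t"
  shows "card {b \<in> B. t \<le> card (N b \<inter> A) \<and> card (N b \<inter> A) \<le> k \<and> N b \<inter> A \<noteq> {}} \<le> t * (4 * c * k + 2) ^ 4 * card A"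
  using assms(1) lin vc mult
proof (induction "card A" arbitrary: A)
  case 0
  then show ?case by simp
next
  case (Suc n)
  let ?B = "\<lambda>A. {b \<in> B. t \<le> card (N b \<inter> A) \<and> card (N b \<inter> A) \<le> k \<and> N b \<inter> A \<noteq> {}}"
  let ?D = "4 * c * k"
  have ne: "A \<noteq> {}"
    using Suc.hyps(2) by auto
  have "shallow_pairs B N k A \<subseteq> A \<times> A"
    by (auto simp: shallow_pairs_def)
  then obtain v where v: "v \<in> A" "card {a. (v, a) \<in> shallow_pairs B N k A} \<le> ?D"
    using exists_low_degree[OF Suc.prems(1) ne _ card_shallow_pairs[OF Suc.prems(1) \<open>k \<ge> 1\<close> Suc.prems(2)]] by blast
  define L where "L = {a. (v, a) \<in> shallow_pairs B N k A}"
  have L: "L \<subseteq> A" "finite L"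
    using Suc.prems(1) finite_subset[of L A] by (auto simp: L_def shallow_pairs_def)
  define Bv where "Bv = {b \<in> ?B A. v \<in> N b}"
  have split: "?B A \<subseteq> Bv \<union> ?B (A - {v})"
  proof
    fix b assume b: "b \<in> ?B A"
    show "b \<in> Bv \<union> ?B (A - {v})"
    proof (cases "v \<in> N b")
      case True
      then show ?thesis using b by (simp add: Bv_def)
    next
      case False
      then have "N b \<inter> (A - {v}) = N b \<inter> A"
        by auto
      then show ?thesis using b by simp
    qed
  qed
  have "card Bv \<le> t * card ((\<lambda>b. N b \<inter> A) ` Bv)"
  proof (rule card_le_fibres)
    show "finite Bv"
      using assms(2) by (simp add: Bv_def)
    fix T assume "T \<in> (\<lambda>b. N b \<inter> A) ` Bv"
    then have "t \<le> card T" "T \<subseteq> A"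
      by (auto simp: Bv_def)
    then obtain X where X: "X \<subseteq> T" "card X = t"
      using obtain_subset_with_card_n by metis
    have "{b \<in> Bv. N b \<inter> A = T} \<subseteq> {b \<in> B. X \<subseteq> N b}"
      using X by (auto simp: Bv_def)
    then have "card {b \<in> Bv. N b \<inter> A = T} \<le> card {b \<in> B. X \<subseteq> N b}"
      using assms(2) by (intro card_mono) auto
    also have "\<dots> \<le> t"
      using X \<open>T \<subseteq> A\<close> by (intro Suc.prems(4)) auto
    finally show "card {b \<in> Bv. N b \<inter> A = T} \<le> t" .
  qed
  also have "card ((\<lambda>b. N b \<inter> A) ` Bv) \<le> (card (insert v L) + 1) ^ 4"
  proof (rule sauer_shelah)
    show "finite (insert v L)"
      using L by simp
    show "(\<lambda>b. N b \<inter> A) ` Bv \<subseteq> Pow (insert v L)"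
      unfolding Bv_def L_def shallow_pairs_def using v(1) by auto
    fix X assume X: "X \<subseteq> insert v L" "card X = Suc 4"
    then have "X \<subseteq> A"
      using L v by auto
    then obtain Y where Y: "Y \<subseteq> X" "\<forall>b\<in>B. N b \<inter> X \<noteq> Y"
      using Suc.prems(3)[of X] X(2) by auto
    show "\<not> shatters ((\<lambda>b. N b \<inter> A) ` Bv) X"
    proof
      assume "shatters ((\<lambda>b. N b \<inter> A) ` Bv) X"
      then have "\<exists>S\<in>(\<lambda>b. N b \<inter> A) ` Bv. S \<inter> X = Y"
        using Y(1) by (rule shattersD)
      then obtain b where "b \<in> Bv" "N b \<inter> A \<inter> X = Y"
        by auto
      moreover have "N b \<inter> A \<inter> X = N b \<inter> X"
        using \<open>X \<subseteq> A\<close> by auto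
      ultimately show False
        using Y(2) by (auto simp: Bv_def)
    qed
  qed
  \<comment> \<open>One unit is for \<open>v\<close> itself, the other is the \<open>+ 1\<close> in
    the Sauer-Shelah bound.\<close>
  also have "\<dots> \<le> (?D + 2) ^ 4"
    using v(2) card_insert_le_m1[of "?D + 1" L v] by (intro power_mono) (auto simp: L_def)
  finally have 1: "card Bv \<le> t * (?D + 2) ^ 4"
    by (simp add: mult_left_mono)
  have 2: "card (?B (A - {v})) \<le> t * (?D + 2) ^ 4 * card (A - {v})"
  proof (rule Suc.hyps(1))
    show "n = card (A - {v})"
      using Suc.hyps(2) v(1) by simp
    show "finite (A - {v})"
      using Suc.prems(1) by simp
    show "card (exact_pairs B N S) \<le> c * card S" if "S \<subseteq> A - {v}" for S
      using that by (intro Suc.prems(2)) auto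
    show "\<exists>Y\<subseteq>X. \<forall>b\<in>B. N b \<inter> X \<noteq> Y" if "X \<subseteq> A - {v}" "card X = 5" for X
      using that by (intro Suc.prems(3)) auto
    show "card {b \<in> B. X \<subseteq> N b} \<le> t" if "X \<subseteq> A - {v}" "card X = t" for X
      using that by (intro Suc.prems(4)) auto
  qed
  have "card (?B A) \<le> card (Bv \<union> ?B (A - {v}))"
    using split assms(2) by (intro card_mono) (auto simp: Bv_def)
  also have "\<dots> \<le> card Bv + card (?B (A - {v}))"
    by (rule card_Un_le)
  also have "\<dots> \<le> t * (?D + 2) ^ 4 + t * (?D + 2) ^ 4 * card (A - {v})"
    using 1 2 by linarith
  also have "\<dots> = t * (?D + 2) ^ 4 * card A"
    using Suc.hyps(2) v(1) by (simp flip: Suc.hyps(2))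
  finally show ?case .
qed

text \<open>Chebyshev's inequality. The rate puts the mean between \<open>16 * t\<close> and
  \<open>32 * t\<close>, so leaving the window from \<open>t\<close> to \<open>64 * t\<close> means
  a deviation of at least \<open>15 * t\<close>, while the variance is at most
  \<open>32 * t\<close>. The condition \<open>k \<ge> 16 * t\<close> keeps \<open>p\<close> a
  probability.\<close>

lemma card_concentration:
  assumes "finite M" "t \<ge> 1" "k \<ge> 16 * t" "k \<le> card M" "card M \<le> 2 * k"
  defines "p \<equiv> 16 * real t / real k"
  shows "1 / 2 \<le> rexp p M (\<lambda>T. of_bool (t \<le> card T \<and> card T \<le> 64 * t))"
proof -
  have k: "real k > 0"
    using assms(2,3) by simp
  have p: "0 \<le> p" "p \<le> 1"
    using assms(3) k by (auto simp: p_def field_simps)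
  define \<mu> where "\<mu> = p * card M"
  have \<mu>: "16 * real t \<le> \<mu>" "\<mu> \<le> 32 * real t"
  proof -
    have "p * k = 16 * t"
      using k by (simp add: p_def)
    moreover have "p * k \<le> \<mu>" "\<mu> \<le> p * (2 * k)"
      unfolding \<mu>_def using p assms(4,5) by (auto intro!: mult_left_mono)
    ultimately show "16 * real t \<le> \<mu>" "\<mu> \<le> 32 * real t"
      by auto
  qed
  have "1 = rexp p M (\<lambda>T. 1)"
    using assms(1) by (simp add: rexp_const)
  \<comment> \<open>Chebyshev pointwise: outside the window the scaled square is already at least
    1.\<close>
  also have "\<dots> \<le> rexp p M (\<lambda>T. of_bool (t \<le> card T \<and> card T \<le> 64 * t) + 1 / (15 * real t)\<^sup>2 * (real (card T) - \<mu>)\<^sup>2)"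
  proof (rule rexp_mono[OF p])
    fix T
    show "1 \<le> of_bool (t \<le> card T \<and> card T \<le> 64 * t) + 1 / (15 * real t)\<^sup>2 * (real (card T) - \<mu>)\<^sup>2"
    proof (cases "t \<le> card T \<and> card T \<le> 64 * t")
      case True
      then show ?thesis by simp
    next
      case False
      then have "real (card T) < real t \<or> real (card T) > 64 * real t"
        by (metis not_le of_nat_less_iff of_nat_mult of_nat_numeral)
      then have "15 * real t \<le> \<bar>real (card T) - \<mu>\<bar>"
        using \<mu> by linarith
      then have "(15 * real t)\<^sup>2 \<le> (real (card T) - \<mu>)\<^sup>2"
        using abs_le_square_iff[of "15 * real t" "real (card T) - \<mu>"] by simp
      moreover have "(15 * real t)\<^sup>2 > 0"
        using assms(2) by simp
      ultimately have "1 \<le> 1 / (15 * real t)\<^sup>2 * (real (card T) - \<mu>)\<^sup>2"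
        by (simp add: le_divide_eq)
      then show ?thesis
        using False by simp
    qed
  qed
  also have "\<dots> = rexp p M (\<lambda>T. of_bool (t \<le> card T \<and> card T \<le> 64 * t)) + 1 / (15 * real t)\<^sup>2 * (p * (1 - p) * card M)"
    using assms(1) by (simp only: rexp_add rexp_cmult rexp_square) (simp add: \<mu>_def)
  finally have 1: "1 \<le> rexp p M (\<lambda>T. of_bool (t \<le> card T \<and> card T \<le> 64 * t)) + 1 / (15 * real t)\<^sup>2 * (p * (1 - p) * card M)" .
  have "p * (1 - p) * card M = \<mu> * (1 - p)"
    by (simp add: \<mu>_def)
  also have "\<dots> \<le> 32 * real t * 1"
    using \<mu> p by (intro mult_mono) auto
  also have "\<dots> \<le> (15 * real t)\<^sup>2 / 2"
  proof -
    have "real t * 1 \<le> real t * real t"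
      using assms(2) by (intro mult_left_mono) auto
    then show ?thesis
      by (simp add: power2_eq_square)
  qed
  finally have "1 / (15 * real t)\<^sup>2 * (p * (1 - p) * card M) \<le> 1 / (15 * real t)\<^sup>2 * ((15 * real t)\<^sup>2 / 2)"
    by (intro mult_left_mono) auto
  also have "\<dots> = 1 / 2"
    using assms(2) by simp
  finally show ?thesis
    using 1 by linarith
qed

text \<open>Sample \<open>A\<close> at rate \<open>16 * t / k\<close>. At least half of these
  members are expected to have a trace within the range of the hypothesis, and the sample has
  expected size \<open>16 * t * card A / k\<close>; the factor 32 absorbs the half.\<close>

lemma card_members_at_scale:
  assumes "finite A" "finite B" "t \<ge> 1" "k \<ge> 16 * t"
    and shallow: "\<And>S. S \<subseteq> A \<Longrightarrow> card {b \<in> B. t \<le> card (N b \<inter> S) \<and> card (N b \<inter> S) \<le> 64 * t \<and> N b \<inter> S \<noteq> {}} \<le> q * card S"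
  shows "card {b \<in> B. k \<le> card (N b \<inter> A) \<and> card (N b \<inter> A) \<le> 2 * k} * k \<le> 32 * t * q * card A"
proof -
  let ?Bk = "{b \<in> B. k \<le> card (N b \<inter> A) \<and> card (N b \<inter> A) \<le> 2 * k}"
  have k: "real k > 0"
    using assms(3,4) by simp
  define p where "p = 16 * real t / real k"
  have p: "0 \<le> p" "p \<le> 1"
    using assms(4) k by (auto simp: p_def field_simps)
  let ?good = "\<lambda>b S. t \<le> card (N b \<inter> S) \<and> card (N b \<inter> S) \<le> 64 * t"
  have "(\<Sum>b\<in>?Bk. 1 / 2) \<le> (\<Sum>b\<in>?Bk. rexp p A (\<lambda>S. of_bool (?good b S)))"
  proof (rule sum_mono)
    fix b assume b: "b \<in> ?Bk"
    have "1 / 2 \<le> rexp p (N b \<inter> A) (\<lambda>T. of_bool (t \<le> card T \<and> card T \<le> 64 * t))"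
      unfolding p_def using b assms(1,3,4) by (intro card_concentration) auto
    also have "\<dots> = rexp p A (\<lambda>S. of_bool (t \<le> card (S \<inter> (N b \<inter> A)) \<and> card (S \<inter> (N b \<inter> A)) \<le> 64 * t))"
      using assms(1) by (intro rexp_inter[symmetric]) auto
    also have "\<dots> = rexp p A (\<lambda>S. of_bool (?good b S))"
    proof (rule rexp_cong)
      fix S assume "S \<subseteq> A"
      then have "S \<inter> (N b \<inter> A) = N b \<inter> S"
        by auto
      then show "(of_bool (t \<le> card (S \<inter> (N b \<inter> A)) \<and> card (S \<inter> (N b \<inter> A)) \<le> 64 * t) :: real) = of_bool (?good b S)"
        by simp
    qed
    finally show "1 / 2 \<le> rexp p A (\<lambda>S. of_bool (?good b S))" .
  qed
  also have "\<dots> = rexp p A (\<lambda>S. \<Sum>b\<in>?Bk. of_bool (?good b S))"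
    by (rule rexp_sum[symmetric])
  also have "\<dots> \<le> rexp p A (\<lambda>S. real q * real (card S))"
  proof (rule rexp_mono[OF p])
    fix S assume S: "S \<subseteq> A"
    have "(\<Sum>b\<in>?Bk. of_bool (?good b S)) = real (card {b \<in> ?Bk. ?good b S})"
      using assms(2) by (simp add: of_bool_def flip: sum.inter_filter)
    also have "card {b \<in> ?Bk. ?good b S} \<le> card {b \<in> B. t \<le> card (N b \<inter> S) \<and> card (N b \<inter> S) \<le> 64 * t \<and> N b \<inter> S \<noteq> {}}"
      using assms(2,3) by (intro card_mono) auto
    also have "\<dots> \<le> q * card S"
      by (rule shallow[OF S])
    finally show "(\<Sum>b\<in>?Bk. of_bool (?good b S)) \<le> real q * real (card S)"
      by simp
  qed
  also have "\<dots> = q * p * card A"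
    using assms(1) by (simp add: rexp_cmult rexp_card)
  finally have "card ?Bk / 2 \<le> q * p * card A"
    by simp
  then have "real (card ?Bk * k) \<le> real (32 * t * q * card A)"
    using k by (simp add: p_def field_simps)
  then show ?thesis
    by (simp only: of_nat_le_iff)
qed

text \<open>A geometric series over the scales \<open>k\<close>, \<open>2 * k\<close>,
  \<open>4 * k\<close> and so on, summed by induction: the bound for \<open>2 * k\<close>
  contributes half of the constant 64, the scale \<open>k\<close> itself the other 32. Once
  \<open>k\<close> exceeds \<open>card A\<close> there are no members.\<close>

lemma card_heavy_members:
  assumes "finite A" "finite B" "t \<ge> 1" "k \<ge> 16 * t"
    and shallow: "\<And>S. S \<subseteq> A \<Longrightarrow> card {b \<in> B. t \<le> card (N b \<inter> S) \<and> card (N b \<inter> S) \<le> 64 * t \<and> N b \<inter> S \<noteq> {}} \<le> q * card S"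
  shows "card {b \<in> B. k \<le> card (N b \<inter> A)} * k \<le> 64 * t * q * card A"
  using assms(4)
proof (induction "Suc (card A) - k" arbitrary: k rule: less_induct)
  case less
  show ?case
  proof (cases "k \<le> card A")
    case False
    have "\<not> k \<le> card (N b \<inter> A)" for b
      using False card_mono[OF assms(1), of "N b \<inter> A"] by auto
    then show ?thesis by simp
  next
    case True
    have "Suc (card A) - 2 * k < Suc (card A) - k" "2 * k \<ge> 16 * t"
      using True less.prems assms(3) by auto
    then have IH: "card {b \<in> B. 2 * k \<le> card (N b \<inter> A)} * (2 * k) \<le> 64 * t * q * card A"
      by (rule less.hyps)
    have "card {b \<in> B. k \<le> card (N b \<inter> A)} \<le>
       card ({b \<in> B. k \<le> card (N b \<inter> A) \<and> card (N b \<inter> A) \<le> 2 * k} \<union> {b \<in> B. 2 * k \<le> card (N b \<inter> A)})"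
      using assms(2) by (intro card_mono) auto
    also have "\<dots> \<le> card {b \<in> B. k \<le> card (N b \<inter> A) \<and> card (N b \<inter> A) \<le> 2 * k} + card {b \<in> B. 2 * k \<le> card (N b \<inter> A)}"
      by (rule card_Un_le)
    finally have "card {b \<in> B. k \<le> card (N b \<inter> A)} * k \<le>
      (card {b \<in> B. k \<le> card (N b \<inter> A) \<and> card (N b \<inter> A) \<le> 2 * k} + card {b \<in> B. 2 * k \<le> card (N b \<inter> A)}) * k"
      by (rule mult_le_mono1)
    moreover have "2 * (card {b \<in> B. 2 * k \<le> card (N b \<inter> A)} * k) \<le> 64 * t * q * card A"
      using IH by (simp only: mult.left_commute)
    moreover note card_members_at_scale[OF assms(1-3) less.prems shallow]
    ultimately show ?thesis
      unfolding add_mult_distrib by linarith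
  qed
qed

subsection \<open>Algebraic intersection numbers of paths\<close>

definition ends_apart :: "(real \<Rightarrow> complex) \<Rightarrow> (real \<Rightarrow> complex) \<Rightarrow> bool" where
  "ends_apart e f \<longleftrightarrow> path e \<and> path f \<and>
     pathstart e \<notin> path_image f \<and> pathfinish e \<notin> path_image f \<and>
     pathstart f \<notin> path_image e \<and> pathfinish f \<notin> path_image e"

text \<open>The winding number around \<open>0\<close> of \<open>e s - f t\<close> as \<open>(s, t)\<close> runs along the boundary of the unit
  square; it is meaningful if neither path passes through an end of the other.\<close>

definition isect :: "(real \<Rightarrow> complex) \<Rightarrow> (real \<Rightarrow> complex) \<Rightarrow> complex" where
  "isect e f = winding_number e (pathstart f) - winding_number e (pathfinish f)
             + winding_number f (pathfinish e) - winding_number f (pathstart e)"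

lemma ends_apart_commute: "ends_apart e f \<longleftrightarrow> ends_apart f e"
  by (auto simp: ends_apart_def)

lemma ends_apart_join:
  assumes "ends_apart e f" "ends_apart e' f" "pathfinish e = pathstart e'"
  shows "ends_apart (e +++ e') f"
  using assms by (auto simp: ends_apart_def path_image_join)

lemma ends_apart_reversepath: "ends_apart (reversepath e) f \<longleftrightarrow> ends_apart e f"
  by (auto simp: ends_apart_def)

lemma ends_apart_disjoint:
  assumes "path e" "path f" "path_image e \<inter> path_image f = {}"
  shows "ends_apart e f"
  using assms pathstart_in_path_image pathfinish_in_path_image
  unfolding ends_apart_def by blast

lemma isect_commute: "isect f e = - isect e f"
  by (simp add: isect_def)

lemma isect_join:
  assumes "ends_apart e f" "ends_apart e' f" "pathfinish e = pathstart e'"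
  shows "isect (e +++ e') f = isect e f + isect e' f"
  using assms by (simp add: isect_def ends_apart_def winding_number_join)

lemma isect_reversepath:
  assumes "ends_apart e f"
  shows "isect (reversepath e) f = - isect e f"
  using assms by (simp add: isect_def ends_apart_def winding_number_reversepath)

text \<open>Exponentiating \<open>2 * pi * \<i>\<close> times a winding number gives the quotient of
  end point minus centre by start point minus centre. The four quotients involve the four
  differences between ends of \<open>e\<close> and ends of \<open>f\<close>, and their combination
  is 1.\<close>

lemma isect_in_Ints:
  assumes "ends_apart e f"
  shows "isect e f \<in> \<int>"
proof -
  have ea: "path e" "path f" "pathstart e \<notin> path_image f" "pathfinish e \<notin> path_image f"
     "pathstart f \<notin> path_image e" "pathfinish f \<notin> path_image e"
    using assms by (simp_all add: ends_apart_def)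
  define E where "E = (\<lambda>x. exp (2 * pi * \<i> * x))"
  have nz: "pathstart e - pathstart f \<noteq> 0" "pathstart e - pathfinish f \<noteq> 0"
           "pathfinish e - pathstart f \<noteq> 0" "pathfinish e - pathfinish f \<noteq> 0"
    using assms by (auto simp: ends_apart_def)
  have E: "E (winding_number p z) = (pathfinish p - z) / (pathstart p - z)"
    if "path p" "z \<notin> path_image p" for p z
  proof -
    have "pathstart p - z \<noteq> 0"
      using that by (metis pathstart_in_path_image right_minus_eq)
    then show ?thesis
      using winding_number_exp_2pi[OF that] by (simp add: E_def field_simps)
  qed
  have one: "(y / x) / (w / z) * ((- w) / (- y)) / ((- z) / (- x)) = 1"
    if "x \<noteq> 0" "y \<noteq> 0" "z \<noteq> 0" "w \<noteq> 0" for x y z w :: complex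
    using that by simp
  have "E (isect e f) = E (winding_number e (pathstart f)) / E (winding_number e (pathfinish f))
             * E (winding_number f (pathfinish e)) / E (winding_number f (pathstart e))"
    by (simp add: E_def isect_def ring_distribs exp_add exp_diff)
  also have "\<dots> = 1"
    using one[OF nz(1,3,2,4)] by (simp only: E ea minus_diff_eq not_False_eq_True)
  finally have "exp (2 * pi * \<i> * isect e f) = 1"
    by (simp add: E_def)
  then obtain n :: int where "Re (2 * pi * \<i> * isect e f) = 0" "Im (2 * pi * \<i> * isect e f) = of_int (2 * n) * pi"
    unfolding exp_eq_1 by blast
  then have "isect e f = of_int n"
    by (auto simp: complex_eq_iff)
  then show ?thesis by simp
qed

text \<open>Disjointness makes \<open>e s - f t\<close> a nonvanishing function on the whole square,
  so it has a continuous logarithm \<open>h\<close>. The four winding numbers are the increments of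
  \<open>h\<close> along the sides and cancel around the boundary.\<close>

lemma isect_disjoint:
  assumes "path e" "path f" "path_image e \<inter> path_image f = {}"
  shows "isect e f = 0"
proof -
  define Q where "Q = ({0..1} \<times> {0..1} :: (real \<times> real) set)"
  have ce: "continuous_on {0..1} e" "continuous_on {0..1} f"
    using assms by (auto simp: path_def)
  have "continuous_on Q (\<lambda>z. e (fst z) - f (snd z))"
    unfolding Q_def by (intro continuous_intros continuous_on_compose2[OF ce(1)] continuous_on_compose2[OF ce(2)]) auto
  moreover have "contractible Q"
    unfolding Q_def by (intro convex_imp_contractible convex_Times) auto
  moreover have "e (fst z) - f (snd z) \<noteq> 0" if "z \<in> Q" for z
  proof -
    have "e (fst z) \<in> path_image e" "f (snd z) \<in> path_image f"
      using that by (auto simp: Q_def path_image_def)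
    then show ?thesis
      using assms(3) by auto
  qed
  ultimately obtain h where h: "continuous_on Q h" "\<And>z. z \<in> Q \<Longrightarrow> e (fst z) - f (snd z) = exp (h z)"
    by (rule continuous_logarithm_on_contractible) auto
  have we: "winding_number e (f t) = (h (1, t) - h (0, t)) / (2 * of_real pi * \<i>)" if "t \<in> {0..1}" for t
  proof -
    have "winding_number e (f t) = winding_number (exp \<circ> (\<lambda>s. h (s, t))) 0"
      unfolding winding_number_offset[of e]
    proof (rule winding_number_cong)
      fix s :: real assume "0 \<le> s" "s \<le> 1"
      then show "e s - f t = (exp \<circ> (\<lambda>s. h (s, t))) s"
        using h(2)[of "(s, t)"] that by (simp add: Q_def)
    qed
    moreover have "path (\<lambda>s. h (s, t))"
      unfolding path_def using that
      by (intro continuous_on_compose2[OF h(1)] continuous_intros) (auto simp: Q_def)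
    ultimately show ?thesis
      by (simp add: winding_number_compose_exp pathstart_def pathfinish_def)
  qed
  have wf: "winding_number f (e s) = (h (s, 1) - h (s, 0)) / (2 * of_real pi * \<i>)" if "s \<in> {0..1}" for s
  proof -
    \<comment> \<open>Here the moving point is \<open>f t - e s\<close>, the negative of the
      function with logarithm \<open>h\<close>; adding \<open>pi * \<i>\<close> accounts for the
      sign.\<close>
    have "winding_number f (e s) = winding_number (exp \<circ> (\<lambda>t. h (s, t) + pi * \<i>)) 0"
      unfolding winding_number_offset[of f]
    proof (rule winding_number_cong)
      fix t :: real assume "0 \<le> t" "t \<le> 1"
      then show "f t - e s = (exp \<circ> (\<lambda>t. h (s, t) + pi * \<i>)) t"
        using h(2)[of "(s, t)"] that by (simp add: Q_def exp_add algebra_simps)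
    qed
    moreover have "path (\<lambda>t. h (s, t) + pi * \<i>)"
      unfolding path_def using that
      by (intro continuous_on_compose2[OF h(1)] continuous_intros) (auto simp: Q_def)
    ultimately show ?thesis
      by (simp add: winding_number_compose_exp pathstart_def pathfinish_def)
  qed
  show ?thesis
    using we[of 0] we[of 1] wf[of 0] wf[of 1]
    by (simp add: isect_def pathstart_def pathfinish_def diff_divide_distrib)
qed

section \<open>Intersection and winding numbers modulo 2\<close>

text \<open>The floor of the real part merely turns a complex number known to be an integer into an
  \<open>int\<close>. Working modulo 2 removes all orientation signs from the later
  cancellations.\<close>

definition isect2 :: "(real \<Rightarrow> complex) \<Rightarrow> (real \<Rightarrow> complex) \<Rightarrow> bit" where
  "isect2 e f = of_int \<lfloor>Re (isect e f)\<rfloor>"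

definition wind2 :: "(real \<Rightarrow> complex) \<Rightarrow> complex \<Rightarrow> bit" where
  "wind2 p z = of_int \<lfloor>Re (winding_number p z)\<rfloor>"

lemma bit_add_self [simp]: "(x::bit) + x = 0" "x + (x + y) = y"
  by (cases x; cases y; simp)+

lemma bit_uminus [simp]: "- (x::bit) = x"
  by (cases x) auto

lemma bit_diff: "x - y = x + (y::bit)"
  by (cases x; cases y) auto

lemma of_int_floor_Ints:
  assumes "x \<in> \<int>"
  shows "(of_int \<lfloor>Re (- x)\<rfloor> :: bit) = of_int \<lfloor>Re x\<rfloor>"
    and "y \<in> \<int> \<Longrightarrow> (of_int \<lfloor>Re (x + y)\<rfloor> :: bit) = of_int \<lfloor>Re x\<rfloor> + of_int \<lfloor>Re y\<rfloor>"
    and "y \<in> \<int> \<Longrightarrow> (of_int \<lfloor>Re (x - y)\<rfloor> :: bit) = of_int \<lfloor>Re x\<rfloor> + of_int \<lfloor>Re y\<rfloor>"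
proof -
  obtain m where m: "x = of_int m"
    using assms by (auto elim!: Ints_cases)
  then have "\<lfloor>Re (- x)\<rfloor> = - m" "\<lfloor>Re x\<rfloor> = m"
    by (simp_all flip: of_int_minus)
  then show "(of_int \<lfloor>Re (- x)\<rfloor> :: bit) = of_int \<lfloor>Re x\<rfloor>"
    by (simp only: of_int_minus bit_uminus)
  assume "y \<in> \<int>"
  then obtain n where n: "y = of_int n"
    by (auto elim!: Ints_cases)
  have "\<lfloor>Re (x + y)\<rfloor> = m + n" "\<lfloor>Re (x - y)\<rfloor> = m - n" "\<lfloor>Re x\<rfloor> = m" "\<lfloor>Re y\<rfloor> = n"
    unfolding m n by (simp_all flip: of_int_add of_int_diff)
  then show "(of_int \<lfloor>Re (x + y)\<rfloor> :: bit) = of_int \<lfloor>Re x\<rfloor> + of_int \<lfloor>Re y\<rfloor>"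
        "(of_int \<lfloor>Re (x - y)\<rfloor> :: bit) = of_int \<lfloor>Re x\<rfloor> + of_int \<lfloor>Re y\<rfloor>"
    by (simp_all only: of_int_add of_int_diff bit_diff)
qed

lemma isect2_commute: "ends_apart e f \<Longrightarrow> isect2 f e = isect2 e f"
  unfolding isect2_def isect_commute[of f e] by (intro of_int_floor_Ints isect_in_Ints)

lemma isect2_join:
  assumes "ends_apart e f" "ends_apart e' f" "pathfinish e = pathstart e'"
  shows "isect2 (e +++ e') f = isect2 e f + isect2 e' f"
  unfolding isect2_def isect_join[OF assms] using assms by (intro of_int_floor_Ints isect_in_Ints)

lemma isect2_reversepath:
  assumes "ends_apart e f"
  shows "isect2 (reversepath e) f = isect2 e f"
  unfolding isect2_def isect_reversepath[OF assms] using assms by (intro of_int_floor_Ints isect_in_Ints)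

lemma isect2_loop:
  assumes "ends_apart e f" "pathfinish e = pathstart e"
  shows "isect2 e f = wind2 e (pathstart f) + wind2 e (pathfinish f)"
proof -
  have "isect e f = winding_number e (pathstart f) - winding_number e (pathfinish f)"
    using assms by (simp add: isect_def)
  then show ?thesis
    using assms unfolding isect2_def wind2_def ends_apart_def
    by (simp only:) (intro of_int_floor_Ints integer_winding_number; simp)
qed

text \<open>The two paths form a loop, and the intersection number of a loop with \<open>f\<close>
  is the difference of its winding numbers around the ends of \<open>f\<close>.\<close>

lemma isect2_change_left:
  assumes "ends_apart e f" "ends_apart e' f" "pathstart e = pathstart e'" "pathfinish e = pathfinish e'"
  shows "isect2 e f = isect2 e' f + wind2 (e +++ reversepath e') (pathstart f)
                                  + wind2 (e +++ reversepath e') (pathfinish f)"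
proof -
  have r: "ends_apart (reversepath e') f"
    using assms by (simp add: ends_apart_reversepath)
  have "isect2 (e +++ reversepath e') f = isect2 e f + isect2 e' f"
    using assms r by (simp add: isect2_join isect2_reversepath)
  moreover have "isect2 (e +++ reversepath e') f
     = wind2 (e +++ reversepath e') (pathstart f) + wind2 (e +++ reversepath e') (pathfinish f)"
    using assms r by (intro isect2_loop ends_apart_join) auto
  ultimately have "isect2 e f + isect2 e' f = wind2 (e +++ reversepath e') (pathstart f)
                                  + wind2 (e +++ reversepath e') (pathfinish f)"
    by simp
  then show ?thesis
    by (metis (no_types, opaque_lifting) bit_add_self(2) add.commute add.assoc)
qed

subsection \<open>Drawings of the complete graph on five vertices\<close>

text \<open>Edges may cross themselves and each other in any way; they only have to avoid the
  vertices that are not their ends. This is what \<open>ends_apart\<close> needs for independent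
  edges.\<close>

definition k5_drawing :: "(nat \<Rightarrow> complex) \<Rightarrow> (nat \<Rightarrow> nat \<Rightarrow> real \<Rightarrow> complex) \<Rightarrow> bool" where
  "k5_drawing v e \<longleftrightarrow> (\<forall>i j. i < j \<and> j < 5 \<longrightarrow>
      path (e i j) \<and> pathstart (e i j) = v i \<and> pathfinish (e i j) = v j \<and>
      (\<forall>k<5. k \<noteq> i \<and> k \<noteq> j \<longrightarrow> v k \<notin> path_image (e i j)))"

text \<open>The fifteen unordered pairs of independent edges, each once. Applied to intersection
  parities this is the van Kampen number of the drawing.\<close>

definition k5_sum :: "(nat \<Rightarrow> nat \<Rightarrow> nat \<Rightarrow> nat \<Rightarrow> bit) \<Rightarrow> bit" where
  "k5_sum E = E 0 1 2 3 + E 0 1 2 4 + E 0 1 3 4 + E 0 2 1 3 + E 0 2 1 4 + E 0 2 3 4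
            + E 0 3 1 2 + E 0 3 1 4 + E 0 3 2 4 + E 0 4 1 2 + E 0 4 1 3 + E 0 4 2 3
            + E 1 2 3 4 + E 1 3 2 4 + E 1 4 2 3"

lemma k5_sum_cong:
  assumes "\<And>i j k l. \<lbrakk>i < j; j < 5; k < l; l < 5; distinct [i, j, k, l]\<rbrakk> \<Longrightarrow> E i j k l = E' i j k l"
  shows "k5_sum E = k5_sum E'"
  unfolding k5_sum_def by (simp add: assms)

lemma k5_drawing_ends_apart:
  assumes "k5_drawing v e" "k5_drawing v e'" "i < j" "j < 5" "k < l" "l < 5" "distinct [i, j, k, l]"
  shows "ends_apart (e i j) (e' k l)"
  using assms unfolding k5_drawing_def ends_apart_def by simp

text \<open>Each correction term \<open>wind2 (e i j +++ reversepath (e' i j)) (v k)\<close> occurs for both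
  edges that join \<open>k\<close> to a vertex other than \<open>i\<close> and \<open>j\<close>, and so cancels.\<close>

lemma k5_sum_unique:
  assumes "k5_drawing v e" "k5_drawing v e'"
  shows "k5_sum (\<lambda>i j k l. isect2 (e i j) (e k l)) = k5_sum (\<lambda>i j k l. isect2 (e' i j) (e' k l))"
proof -
  define X where "X = (\<lambda>i j k. wind2 (e i j +++ reversepath (e' i j)) (v k))"
  have "isect2 (e i j) (e k l) = isect2 (e' i j) (e' k l) + X i j k + X i j l + X k l i + X k l j"
    if "i < j" "j < 5" "k < l" "l < 5" "distinct [i, j, k, l]" for i j k l
  proof -
    have d: "distinct [k, l, i, j]"
      using that by auto
    note apart = k5_drawing_ends_apart[OF _ _ that] k5_drawing_ends_apart[OF _ _ that(3,4,1,2) d]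
    have ends: "pathstart (e i j) = v i" "pathfinish (e i j) = v j" "pathstart (e' i j) = v i" "pathfinish (e' i j) = v j"
      "pathstart (e k l) = v k" "pathfinish (e k l) = v l" "pathstart (e' k l) = v k" "pathfinish (e' k l) = v l"
      using assms that by (simp_all add: k5_drawing_def)
    have "isect2 (e i j) (e k l) = isect2 (e' i j) (e k l) + X i j k + X i j l"
      using isect2_change_left[of "e i j" "e k l" "e' i j"] apart assms ends by (simp add: X_def)
    moreover have "isect2 (e k l) (e' i j) = isect2 (e' k l) (e' i j) + X k l i + X k l j"
      using isect2_change_left[of "e k l" "e' i j" "e' k l"] apart assms ends by (simp add: X_def)
    moreover have "isect2 (e k l) (e' i j) = isect2 (e' i j) (e k l)"
        "isect2 (e' k l) (e' i j) = isect2 (e' i j) (e' k l)"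
      using apart assms isect2_commute by blast+
    ultimately show ?thesis
      by (simp only: add_ac)
  qed
  then have "k5_sum (\<lambda>i j k l. isect2 (e i j) (e k l)) =
     k5_sum (\<lambda>i j k l. isect2 (e' i j) (e' k l) + X i j k + X i j l + X k l i + X k l j)"
    by (intro k5_sum_cong)
  also have "\<dots> = k5_sum (\<lambda>i j k l. isect2 (e' i j) (e' k l))"
    unfolding k5_sum_def by (simp only: add_ac bit_add_self add_0 add_0_right)
  finally show ?thesis .
qed

lemma ends_apart_conjugate:
  assumes "ends_apart c f" "ends_apart s f" "ends_apart d f"
    "pathstart s = pathstart c" "pathfinish s = pathstart d"
  shows "ends_apart (reversepath c +++ s +++ d) f"
  using assms by (simp add: ends_apart_join ends_apart_reversepath)

lemma isect2_conjugate:
  assumes "ends_apart c f" "ends_apart s f" "ends_apart d f"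
    "pathstart s = pathstart c" "pathfinish s = pathstart d"
  shows "isect2 (reversepath c +++ s +++ d) f = isect2 c f + isect2 s f + isect2 d f"
proof -
  have "isect2 (reversepath c +++ s +++ d) f = isect2 (reversepath c) f + isect2 (s +++ d) f"
    using assms by (intro isect2_join) (simp_all add: ends_apart_join ends_apart_reversepath)
  also have "\<dots> = isect2 c f + (isect2 s f + isect2 d f)"
    using assms by (simp only: isect2_join isect2_reversepath)
  finally show ?thesis
    by (simp only: add_ac)
qed

text \<open>Drag every vertex along its path \<open>c i\<close> and extend the edges accordingly. A
  term of \<open>c i\<close> with an edge \<open>k l\<close> occurs for both remaining choices of
  \<open>j\<close>, and a term of \<open>c i\<close> with \<open>c k\<close> occurs for the six
  ordered choices of the other ends; both counts are even.\<close>

lemma k5_sum_move_vertices: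
  assumes s: "k5_drawing u s"
    and c: "\<And>i. i < 5 \<Longrightarrow> path (c i) \<and> pathstart (c i) = u i \<and> pathfinish (c i) = v i"
    and uc: "\<And>i k. \<lbrakk>i < 5; k < 5; k \<noteq> i\<rbrakk> \<Longrightarrow> u k \<notin> path_image (c i)"
    and vc: "\<And>i k. \<lbrakk>i < 5; k < 5; k \<noteq> i\<rbrakk> \<Longrightarrow> v k \<notin> path_image (c i)"
    and vs: "\<And>i j k. \<lbrakk>i < j; j < 5; k < 5\<rbrakk> \<Longrightarrow> v k \<notin> path_image (s i j)"
  defines "e \<equiv> (\<lambda>i j. reversepath (c i) +++ s i j +++ c j)"
  shows "k5_drawing v e"
    and "k5_sum (\<lambda>i j k l. isect2 (e i j) (e k l)) = k5_sum (\<lambda>i j k l. isect2 (s i j) (s k l))"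
proof -
  have sp: "path (s i j)" "pathstart (s i j) = u i" "pathfinish (s i j) = u j"
    if "i < j" "j < 5" for i j
    using s that by (auto simp: k5_drawing_def)
  show drawing: "k5_drawing v e"
    unfolding k5_drawing_def
  proof (intro allI impI, elim conjE)
    fix i j :: nat assume ij: "i < j" "j < 5"
    show "path (e i j) \<and> pathstart (e i j) = v i \<and> pathfinish (e i j) = v j \<and>
      (\<forall>k<5. k \<noteq> i \<and> k \<noteq> j \<longrightarrow> v k \<notin> path_image (e i j))"
      using c[of i] c[of j] sp[OF ij] vc[of i] vc[of j] vs[of i j] ij
      by (auto simp: e_def path_image_join)
  qed
  have cc: "ends_apart (c i) (c k)" if "i < 5" "k < 5" "i \<noteq> k" for i k
    using that c[of i] c[of k] uc[of i k] uc[of k i] vc[of i k] vc[of k i] by (simp add: ends_apart_def)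
  have ss: "ends_apart (s i j) (s k l)" if "i < j" "j < 5" "k < l" "l < 5" "distinct [i, j, k, l]" for i j k l
    using k5_drawing_ends_apart[OF s s that] .
  have cs: "ends_apart (c i) (s k l)" if "i < 5" "k < l" "l < 5" "i \<noteq> k" "i \<noteq> l" for i k l
    using that c[of i] sp[of k l] uc[of i k] uc[of i l] vs[of k l i] s by (simp add: ends_apart_def k5_drawing_def)
  define C where "C = (\<lambda>i k l. isect2 (c i) (s k l))"
  define D where "D = (\<lambda>i k. isect2 (c (min i k)) (c (max i k)))"
  have D: "isect2 (c i) (c k) = D i k" if "i < 5" "k < 5" "i \<noteq> k" for i k
    using that cc isect2_commute[OF cc[OF that]] by (simp add: D_def min_def max_def)
  have D_commute: "D i k = D k i" for i k
    by (simp add: D_def min.commute max.commute)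
  have "isect2 (e i j) (e k l) = isect2 (s i j) (s k l) + C i k l + C j k l + C k i j + C l i j
       + D i k + D i l + D j k + D j l"
    if "i < j" "j < 5" "k < l" "l < 5" "distinct [i, j, k, l]" for i j k l
  proof -
    have lt: "i < 5" "k < 5" and ne: "i \<noteq> k" "i \<noteq> l" "j \<noteq> k" "j \<noteq> l"
      using that by auto
    have glue: "pathstart (s i j) = pathstart (c i)" "pathfinish (s i j) = pathstart (c j)"
       "pathstart (s k l) = pathstart (c k)" "pathfinish (s k l) = pathstart (c l)"
      using that lt sp c by auto
    have right: "isect2 f (e k l) = isect2 f (c k) + isect2 f (s k l) + isect2 f (c l)"
                "ends_apart f (e k l)"
      if "ends_apart f (c k)" "ends_apart f (s k l)" "ends_apart f (c l)" for f
    proof -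
      have sw: "ends_apart (c k) f" "ends_apart (s k l) f" "ends_apart (c l) f"
        using that by (simp_all add: ends_apart_commute)
      note conj = ends_apart_conjugate[OF sw glue(3,4)] isect2_conjugate[OF sw glue(3,4)]
      show "ends_apart f (e k l)"
        using conj(1) unfolding e_def by (simp add: ends_apart_commute)
      show "isect2 f (e k l) = isect2 f (c k) + isect2 f (s k l) + isect2 f (c l)"
        using conj sw isect2_commute unfolding e_def by metis
    qed
    have a: "ends_apart (c i) (c k)" "ends_apart (c i) (s k l)" "ends_apart (c i) (c l)"
            "ends_apart (c j) (c k)" "ends_apart (c j) (s k l)" "ends_apart (c j) (c l)"
            "ends_apart (s i j) (c k)" "ends_apart (s i j) (s k l)" "ends_apart (s i j) (c l)"
      using cc cs ss that lt ne ends_apart_commute by metis+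
    have "isect2 (e i j) (e k l) = isect2 (c i) (e k l) + isect2 (s i j) (e k l) + isect2 (c j) (e k l)"
      using isect2_conjugate[of "c i" "e k l" "s i j" "c j"] right(2) a glue by (simp add: e_def)
    moreover have "isect2 (s i j) (c k) = C k i j" "isect2 (s i j) (c l) = C l i j"
      using a isect2_commute unfolding C_def by metis+
    ultimately show ?thesis
      by (simp only: right(1)[OF a(1-3)] right(1)[OF a(4-6)] right(1)[OF a(7-9)] D lt that ne
          not_False_eq_True C_def add_ac)
  qed
  then have "k5_sum (\<lambda>i j k l. isect2 (e i j) (e k l)) =
     k5_sum (\<lambda>i j k l. isect2 (s i j) (s k l) + C i k l + C j k l + C k i j + C l i j
       + D i k + D i l + D j k + D j l)"
    by (intro k5_sum_cong)
  also have "\<dots> = k5_sum (\<lambda>i j k l. isect2 (s i j) (s k l))"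
    unfolding k5_sum_def by (simp only: add_ac D_commute bit_add_self add_0 add_0_right)
  finally show "k5_sum (\<lambda>i j k l. isect2 (e i j) (e k l)) = k5_sum (\<lambda>i j k l. isect2 (s i j) (s k l))" .
qed

lemma isect2_disjoint:
  assumes "path e" "path f" "path_image e \<inter> path_image f = {}"
  shows "isect2 e f = 0"
  by (simp add: isect2_def isect_disjoint[OF assms])

text \<open>A straight-line drawing in which the only crossing of independent edges is that of
  \<open>34\<close> and \<open>02\<close>: vertex \<open>4\<close> lies inside the triangle \<open>012\<close> and vertex \<open>3\<close> outside.\<close>

definition k5_point :: "nat \<Rightarrow> complex" where
  "k5_point i = [Complex 0 1, Complex (-2) (-2), Complex 2 (-2), Complex 1 4, Complex 0 0] ! i"

lemma k5_point_simps [simp]: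
  "k5_point 0 = Complex 0 1" "k5_point (Suc 0) = Complex (-2) (-2)" "k5_point 2 = Complex 2 (-2)"
  "k5_point 3 = Complex 1 4" "k5_point 4 = Complex 0 0"
  by (simp_all add: k5_point_def numeral_eq_Suc)

lemma less_5_cases: "(i::nat) < 5 \<longleftrightarrow> i = 0 \<or> i = 1 \<or> i = 2 \<or> i = 3 \<or> i = 4"
  by auto

lemma k5_point_notin_segment:
  assumes "i < j" "j < 5" "k < 5" "k \<noteq> i" "k \<noteq> j"
  shows "k5_point k \<notin> closed_segment (k5_point i) (k5_point j)"
proof
  assume "k5_point k \<in> closed_segment (k5_point i) (k5_point j)"
  then obtain t where t: "0 \<le> t" "t \<le> 1"
    "k5_point k = (1 - t) *\<^sub>R k5_point i + t *\<^sub>R k5_point j"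
    by (auto simp: closed_segment_def)
  have "Re (k5_point k) = (1 - t) * Re (k5_point i) + t * Re (k5_point j)"
       "Im (k5_point k) = (1 - t) * Im (k5_point i) + t * Im (k5_point j)"
    by (simp_all add: t(3))
  moreover have "i = 0 \<or> i = 1 \<or> i = 2 \<or> i = 3" "j = 1 \<or> j = 2 \<or> j = 3 \<or> j = 4"
      "k = 0 \<or> k = 1 \<or> k = 2 \<or> k = 3 \<or> k = 4"
    using assms by linarith+
  ultimately show False
    using t(1,2) assms by (elim disjE; simp)
qed

text \<open>All independent pairs except those of \<open>34\<close> with a side of the triangle
  \<open>012\<close>; these three are evaluated together through the winding number of the
  triangle.\<close>

lemma k5_segments_disjoint:
  assumes "(i, j, k, l) \<in> {(0,1,2,3), (0,1,2,4), (0,2,1,3), (0,2,1,4), (0,3,1,2), (0,3,1,4), (0,3,2,4),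
     (0,4,1,2), (0,4,1,3), (0,4,2,3), (1,3,2,4), (1,4,2,3)}"
  shows "closed_segment (k5_point i) (k5_point j) \<inter> closed_segment (k5_point k) (k5_point l) = {}"
proof (rule ccontr)
  assume "\<not> ?thesis"
  then obtain s t where st: "0 \<le> s" "s \<le> 1" "0 \<le> t" "t \<le> 1" and
    eq: "(1 - s) *\<^sub>R k5_point i + s *\<^sub>R k5_point j = (1 - t) *\<^sub>R k5_point k + t *\<^sub>R k5_point l"
    by (auto simp: closed_segment_def)
  have "(1 - s) * Re (k5_point i) + s * Re (k5_point j) = (1 - t) * Re (k5_point k) + t * Re (k5_point l)"
       "(1 - s) * Im (k5_point i) + s * Im (k5_point j) = (1 - t) * Im (k5_point k) + t * Im (k5_point l)"
    using arg_cong[OF eq, of Re] arg_cong[OF eq, of Im] by simp_all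
  then show False
    using assms st by (simp; elim disjE conjE; simp)
qed

text \<open>The three remaining pairs add up to the intersection of the triangle with the edge
  \<open>34\<close>, which is odd because the triangle winds once around vertex 4 and not around
  vertex 3. The shift \<open>M\<close> allows the drawing to be placed away from any given
  points.\<close>

lemma k5_standard_drawing:
  fixes M :: complex
  defines "u \<equiv> (\<lambda>i. M + k5_point i)"
  defines "s \<equiv> (\<lambda>i j. linepath (u i) (u j))"
  shows "k5_drawing u s" and "k5_sum (\<lambda>i j k l. isect2 (s i j) (s k l)) = 1"
proof -
  have seg: "path_image (s i j) = (+) M ` closed_segment (k5_point i) (k5_point j)" for i j
    by (simp add: s_def u_def closed_segment_translation)
  show drawing: "k5_drawing u s"
    unfolding k5_drawing_def
    using k5_point_notin_segment by (auto simp: seg) (auto simp: s_def u_def)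
  have disj: "isect2 (s i j) (s k l) = 0"
    if "closed_segment (k5_point i) (k5_point j) \<inter> closed_segment (k5_point k) (k5_point l) = {}" for i j k l
  proof (rule isect2_disjoint)
    show "path_image (s i j) \<inter> path_image (s k l) = {}"
      using that unfolding seg by auto
  qed (simp_all add: s_def)
  define T where "T = linepath (u 0) (u 1) +++ linepath (u 1) (u 2) +++ linepath (u 2) (u 0)"
  have apart: "ends_apart (s 0 1) (s 3 4)" "ends_apart (s 1 2) (s 3 4)" "ends_apart (s 0 2) (s 3 4)"
    by (rule k5_drawing_ends_apart[OF drawing drawing]; simp)+
  have T: "T = s 0 1 +++ s 1 2 +++ reversepath (s 0 2)"
    by (simp add: T_def s_def)
  have glue: "pathfinish (s 1 2) = pathstart (reversepath (s 0 2))"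
    by (simp add: s_def)
  have r: "ends_apart (reversepath (s 0 2)) (s 3 4)"
    using apart by (simp only: ends_apart_reversepath)
  note apart' = r ends_apart_join[OF apart(2) r glue]
  have "isect2 T (s 3 4) = isect2 (s 0 1) (s 3 4) + isect2 (s 1 2 +++ reversepath (s 0 2)) (s 3 4)"
    unfolding T using apart apart' by (intro isect2_join) (auto simp: s_def)
  also have "isect2 (s 1 2 +++ reversepath (s 0 2)) (s 3 4) = isect2 (s 1 2) (s 3 4) + isect2 (reversepath (s 0 2)) (s 3 4)"
    using apart apart' by (intro isect2_join) (auto simp: s_def)
  also have "isect2 (reversepath (s 0 2)) (s 3 4) = isect2 (s 0 2) (s 3 4)"
    using apart by (simp add: isect2_reversepath)
  finally have 1: "isect2 T (s 3 4) = isect2 (s 0 1) (s 3 4) + (isect2 (s 1 2) (s 3 4) + isect2 (s 0 2) (s 3 4))" .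
  have "ends_apart T (s 3 4)"
    unfolding T by (rule ends_apart_join[OF apart(1) apart'(2)]) (simp add: s_def)
  moreover have "pathfinish T = pathstart T"
    by (simp add: T_def)
  ultimately have 2: "isect2 T (s 3 4) = wind2 T (u 3) + wind2 T (u 4)"
    using isect2_loop by (simp add: s_def)
  have T_im: "path_image T \<subseteq> {z. Im z \<le> Im M + 1}"
  proof -
    have "closed_segment (u i) (u j) \<subseteq> {z. Im z \<le> Im M + 1}" if "i \<in> {0,1,2}" "j \<in> {0,1,2}" for i j
      using that by (intro closed_segment_subset) (auto simp: u_def convex_halfspace_Im_le)
    then show ?thesis
      unfolding T_def by (simp add: path_image_join)
  qed
  have "winding_number T (u 3) = 0"
    by (rule winding_number_zero_outside[OF _ _ _ _ T_im])
       (auto simp: T_def u_def convex_halfspace_Im_le)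
  moreover have "winding_number T (u 4) \<in> {1, -1}"
  proof -
    have "u 4 \<notin> closed_segment (u 0) (u 1) \<union> closed_segment (u 1) (u 2) \<union> closed_segment (u 2) (u 0)"
      using drawing unfolding k5_drawing_def s_def by (auto simp: closed_segment_commute[of "u 2" "u 0"])
    moreover have "u 4 \<in> convex hull {u 0, u 1, u 2}"
    proof -
      have "u 4 = (2/3::real) *\<^sub>R u 0 + (1/6::real) *\<^sub>R u 1 + (1/6::real) *\<^sub>R u 2"
        by (simp add: u_def complex_eq_iff field_simps)
      then show ?thesis
        unfolding convex_hull_3 by (intro CollectI exI[of _ "2/3"] exI[of _ "1/6"]) auto
    qed
    ultimately have "u 4 \<in> interior (convex hull {u 0, u 1, u 2})"
      by (subst interior_of_triangle) auto
    from winding_number_triangle[OF this] show ?thesis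
      unfolding T_def by (auto split: if_splits)
  qed
  moreover have "\<lfloor>- 1 :: real\<rfloor> = - 1"
    by linarith
  ultimately have "isect2 T (s 3 4) = 1"
    unfolding 2 wind2_def by auto
  then have "isect2 (s 0 1) (s 3 4) + (isect2 (s 1 2) (s 3 4) + isect2 (s 0 2) (s 3 4)) = 1"
    unfolding 1 .
  moreover have "k5_sum (\<lambda>i j k l. isect2 (s i j) (s k l)) =
    isect2 (s 0 1) (s 3 4) + (isect2 (s 1 2) (s 3 4) + isect2 (s 0 2) (s 3 4))"
    unfolding k5_sum_def
    by (simp only: disj[OF k5_segments_disjoint] insert_iff simp_thms add_0 add_0_right add_ac)
  ultimately show "k5_sum (\<lambda>i j k l. isect2 (s i j) (s k l)) = 1"
    by simp
qed

text \<open>A standard drawing, placed far away, is dragged onto the vertices \<open>v\<close>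
  without changing its odd sum, and the sum depends only on the vertices. If all independent pairs
  had intersection number 0, the sum would be even.\<close>

theorem k5_crossing:
  assumes drawing: "k5_drawing v e"
  shows "\<exists>i j k l. i < j \<and> j < 5 \<and> k < l \<and> l < 5 \<and> distinct [i, j, k, l] \<and> isect (e i j) (e k l) \<noteq> 0"
proof (rule ccontr)
  assume no: "\<not> ?thesis"
  have "isect2 (e i j) (e k l) = 0"
    if "i < j" "j < 5" "k < l" "l < 5" "distinct [i, j, k, l]" for i j k l
  proof -
    have "isect (e i j) (e k l) = 0"
      using no that by blast
    then show ?thesis by (simp add: isect2_def)
  qed
  then have "k5_sum (\<lambda>i j k l. isect2 (e i j) (e k l)) = k5_sum (\<lambda>i j k l. 0)"
    by (intro k5_sum_cong)
  then have zero: "k5_sum (\<lambda>i j k l. isect2 (e i j) (e k l)) = 0"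
    by (simp add: k5_sum_def)
  have v_ne: "v i \<noteq> v k" if "i < 5" "k < 5" "i < k" for i k
  proof -
    \<comment> \<open>A third vertex: the edge joining \<open>i\<close> and \<open>j\<close>
      contains \<open>v i\<close> but not \<open>v k\<close>.\<close>
    define j where "j = (if i = 0 then if k = 1 then 2 else 1 else 0 :: nat)"
    have "j < 5" "j \<noteq> i" "j \<noteq> k"
      using that by (auto simp: j_def)
    then have "v k \<notin> path_image (e (min i j) (max i j)) \<and> v i \<in> path_image (e (min i j) (max i j))"
      using drawing that unfolding k5_drawing_def
      by (metis max_def min_def nat_neq_iff nless_le pathfinish_in_path_image pathstart_in_path_image)
    then show ?thesis by auto
  qed
  then have v_ne': "v i \<noteq> v k" if "i < 5" "k < 5" "i \<noteq> k" for i k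
    using that by (metis nat_neq_iff)
  \<comment> \<open>The leftmost standard point has real part -2, so a shift by \<open>R\<close>
    puts the whole standard drawing strictly to the right of every \<open>v k\<close>.\<close>
  define R where "R = (\<Sum>i<5. \<bar>Re (v i)\<bar>) + 3"
  define u where "u = (\<lambda>i. of_real R + k5_point i)"
  define s where "s = (\<lambda>i j. linepath (u i) (u j))"
  have std: "k5_drawing u s" "k5_sum (\<lambda>i j k l. isect2 (s i j) (s k l)) = 1"
    unfolding u_def s_def by (rule k5_standard_drawing)+
  have Re_v: "Re (v k) \<le> R - 3" if "k < 5" for k
    using member_le_sum[of k "{..<5}" "\<lambda>i. \<bar>Re (v i)\<bar>"] that by (simp add: R_def)
  have Re_u: "Re (u k) \<ge> R - 2" if "k < 5" for k
    using that unfolding less_5_cases by (auto simp: u_def)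
  have vs: "v k \<notin> path_image (s i j)" if "i < j" "j < 5" "k < 5" for i j k
  proof -
    have "closed_segment (u i) (u j) \<subseteq> {z. Re z \<ge> R - 2}"
      using Re_u[of i] Re_u[of j] that by (intro closed_segment_subset) (auto simp: convex_halfspace_Re_ge)
    then show ?thesis
      using Re_v[of k] that by (auto simp: s_def)
  qed
  have u_ne: "u i \<noteq> u k" if "i < 5" "k < 5" "i \<noteq> k" for i k
    using that unfolding less_5_cases by (auto simp: u_def)
  have uv: "u i \<noteq> v k" if "i < 5" "k < 5" for i k
    using Re_u[of i] Re_v[of k] that by auto
  have "\<exists>c. path c \<and> path_image c \<subseteq> - (u ` ({..<5} - {i}) \<union> v ` ({..<5} - {i})) \<and>
            pathstart c = u i \<and> pathfinish c = v i" if "i < 5" for i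
  proof -
    \<comment> \<open>A finite set does not separate the plane, so each dragging path can avoid all
      other old and new vertices.\<close>
    have "path_connected (- (u ` ({..<5} - {i}) \<union> v ` ({..<5} - {i})))"
      by (intro path_connected_complement_countable countable_finite) auto
    moreover have "u i \<in> - (u ` ({..<5} - {i}) \<union> v ` ({..<5} - {i}))"
      using u_ne[OF that] uv[OF that] by auto
    moreover have "v i \<in> - (u ` ({..<5} - {i}) \<union> v ` ({..<5} - {i}))"
      using uv[OF _ that] v_ne'[OF that] by force
    ultimately show ?thesis
      unfolding path_connected_def by blast
  qed
  then obtain c where c: "\<And>i. i < 5 \<Longrightarrow> path (c i) \<and>
      path_image (c i) \<subseteq> - (u ` ({..<5} - {i}) \<union> v ` ({..<5} - {i})) \<and>
            pathstart (c i) = u i \<and> pathfinish (c i) = v i"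
    by metis
  have uc: "u k \<notin> path_image (c i)" "v k \<notin> path_image (c i)" if "i < 5" "k < 5" "k \<noteq> i" for i k
    using c[OF that(1)] that(2,3) by auto
  have c': "path (c i) \<and> pathstart (c i) = u i \<and> pathfinish (c i) = v i" if "i < 5" for i
    using c[OF that] by blast
  note moved = k5_sum_move_vertices[OF std(1) c' uc vs]
  have "k5_sum (\<lambda>i j k l. isect2 (e i j) (e k l)) = 1"
    using k5_sum_unique[OF drawing moved(1)] moved(2) std(2) by simp
  with zero show False by simp
qed

subsection \<open>Jordan regions\<close>

lemma jordan_region_topology:
  assumes "jordan_region S"
  shows "compact S" "connected (- S)" "connected (interior S)" "closure (interior S) = S"
    "path_connected (frontier S)"
    "\<exists>\<gamma>. simple_path \<gamma> \<and> pathfinish \<gamma> = pathstart \<gamma> \<and> frontier S = path_image \<gamma>"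
proof -
  obtain \<gamma> where \<gamma>: "simple_path \<gamma>" "pathfinish \<gamma> = pathstart \<gamma>"
    and S: "S = path_image \<gamma> \<union> inside (path_image \<gamma>)"
    using assms unfolding jordan_region_def by blast
  note J = Jordan_inside_outside[OF \<gamma>]
  have out: "- S = outside (path_image \<gamma>)"
    using J unfolding S by blast
  have fr: "frontier S = path_image \<gamma>"
    using J out by (metis frontier_complement)
  have "closed S"
    using J out by (simp add: closed_def)
  moreover have "bounded S"
    using J unfolding S by (simp add: bounded_simple_path_image \<gamma>)
  ultimately show "compact S"
    by (simp add: compact_eq_bounded_closed)
  have "S - interior S = path_image \<gamma>"
    using fr \<open>closed S\<close> by (simp add: frontier_def)
  then have int: "interior S = inside (path_image \<gamma>)"
    using interior_subset[of S] inside_no_overlap[of "path_image \<gamma>"] S by blast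
  show "connected (- S)" "connected (interior S)"
    using J out int by auto
  show "closure (interior S) = S"
    using J int closure_Un_frontier[of "inside (path_image \<gamma>)"] S by auto
  show "path_connected (frontier S)"
    using fr \<gamma> by (simp add: path_connected_path_image simple_path_imp_path)
  show "\<exists>\<gamma>. simple_path \<gamma> \<and> pathfinish \<gamma> = pathstart \<gamma> \<and> frontier S = path_image \<gamma>"
    using \<gamma> fr by blast
qed

text \<open>Any point reaches the boundary inside \<open>S\<close> along a segment towards a point
  outside \<open>S\<close>, and the boundary is itself the image of a path.\<close>

lemma jordan_region_path_connected:
  assumes "jordan_region S"
  shows "path_connected S"
proof -
  note J = jordan_region_topology[OF assms]
  have cl: "closed S"
    using J(1) by (simp add: compact_imp_closed)
  obtain y where y: "y \<notin> S"
    using J(1) by (metis compact_imp_bounded not_bounded_UNIV UNIV_eq_I)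
  have to_frontier: "\<exists>z\<in>frontier S. path_component S x z" if x: "x \<in> S" for x
  proof -
    obtain h where "path h" "pathstart h = x" "path_image h \<subseteq> S" "pathfinish h \<in> frontier S"
      by (rule exists_path_subpath_to_frontier_closed[OF cl, of "linepath x y"]) (use x y in auto)
    then show ?thesis
      unfolding path_component_def by blast
  qed
  have "path_component S x y" if xy: "x \<in> S" "y \<in> S" for x y
  proof -
    obtain z w where zw: "z \<in> frontier S" "path_component S x z" "w \<in> frontier S" "path_component S y w"
      using to_frontier[OF xy(1)] to_frontier[OF xy(2)] by blast
    have "path_component (frontier S) z w"
      using J(5) zw by (simp add: path_connected_component)
    then have "path_component S z w"
      using frontier_subset_closed[OF cl] path_component_of_subset by blast
    then show ?thesis
      using zw by (meson path_component_sym path_component_trans)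
  qed
  then show ?thesis
    by (simp add: path_connected_component)
qed

text \<open>Padding \<open>X\<close> to exactly two distinct points lets zero, one and two boundary
  intersections be treated alike: the curve always splits into two arcs whose interiors avoid
  \<open>X\<close>.\<close>

lemma jordan_region_frontier_arcs:
  assumes "jordan_region S" "finite X" "card X \<le> 2" "X \<subseteq> frontier S"
  obtains u v P Q where "X \<subseteq> {u, v}" "frontier S = P \<union> Q" "P \<inter> Q = {u, v}"
    "connected P" "connected Q" "connected (P - {u, v})" "connected (Q - {u, v})"
    "P \<subseteq> closure (P - {u, v})" "Q \<subseteq> closure (Q - {u, v})"
proof -
  obtain \<gamma> where \<gamma>: "simple_path \<gamma>" "pathfinish \<gamma> = pathstart \<gamma>" "frontier S = path_image \<gamma>"
    using jordan_region_topology(6)[OF assms(1)] by blast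
  have "x = y \<or> x = 0 \<and> y = 1 \<or> x = 1 \<and> y = 0" if "x \<in> {0..1}" "y \<in> {0..1}" "\<gamma> x = \<gamma> y" for x y
    using \<gamma>(1) that unfolding simple_path_def loop_free_def by blast
  from this[of 0 "1/2"] have "\<gamma> 0 \<noteq> \<gamma> (1/2)"
    by auto
  moreover have "\<gamma> 0 \<in> frontier S" "\<gamma> (1/2) \<in> frontier S"
    by (auto simp: \<gamma>(3) path_image_def)
  ultimately obtain a b where ab: "a \<noteq> b" "a \<in> frontier S" "b \<in> frontier S"
    by blast
  have "2 \<le> card (X \<union> {a, b})"
    using ab(1) card_mono[of "X \<union> {a, b}" "{a, b}"] assms(2) by simp
  then obtain Y where Y: "X \<subseteq> Y" "Y \<subseteq> X \<union> {a, b}" "card Y = 2"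
    using exists_subset_between[of X 2 "X \<union> {a, b}"] assms by auto
  then obtain u v where uv: "Y = {u, v}" "u \<noteq> v"
    by (auto simp: card_2_iff)
  then have "u \<in> path_image \<gamma>" "v \<in> path_image \<gamma>"
    using Y ab assms(4) \<gamma>(3) by auto
  then obtain p q where pq: "arc p" "arc q" "pathstart p = u" "pathfinish p = v" "pathstart q = v"
     "pathfinish q = u" "path_image p \<inter> path_image q = {u, v}" "path_image p \<union> path_image q = path_image \<gamma>"
    using exists_double_arc[OF \<gamma>(1,2) _ _ uv(2)] by metis
  have arc: "connected (path_image c)" "connected (path_image c - {pathstart c, pathfinish c})"
     "path_image c \<subseteq> closure (path_image c - {pathstart c, pathfinish c})" if "arc c" for c :: "real \<Rightarrow> complex"
  proof -
    have c: "simple_path c" "path c"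
      using that by (auto simp: arc_imp_simple_path arc_imp_path)
    show "connected (path_image c)"
      using c by (simp add: connected_path_image)
    show "connected (path_image c - {pathstart c, pathfinish c})"
      using c by (simp add: connected_simple_path_endless)
    have "c ` closure {0<..<1} \<subseteq> closure (c ` {0<..<1})"
      using c by (intro image_closure_subset closure_subset) (auto simp: path_def)
    then show "path_image c \<subseteq> closure (path_image c - {pathstart c, pathfinish c})"
      using simple_path_endless[OF c(1)] by (simp add: path_image_def)
  qed
  have "{v, u} = {u, v}" by auto
  then show thesis
    using that[of u v "path_image p" "path_image q"] arc[OF pq(1)] arc[OF pq(2)] pq Y uv \<gamma>(3) by simp
qed

section \<open>Relative position of two pseudo-discs\<close>

lemma connected_disjoint_frontier:
  assumes "connected C" "C \<inter> frontier S = {}"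
  shows "C \<subseteq> interior S \<or> C \<inter> S = {}"
  using assms connected_Int_frontier[of C S] interior_subset closure_subset
  unfolding frontier_def by blast

text \<open>The complement of \<open>D\<close> is connected and misses the boundary of
  \<open>E\<close>. Being unbounded, it cannot lie inside \<open>E\<close>, so it misses
  \<open>E\<close>.\<close>

lemma frontier_subset_jordan_region:
  assumes "jordan_region D" "jordan_region E" "frontier E \<subseteq> D"
  shows "E \<subseteq> D"
proof -
  have "- D \<subseteq> interior E \<or> - D \<inter> E = {}"
    using assms by (intro connected_disjoint_frontier) (auto simp: jordan_region_topology)
  moreover have "\<not> - D \<subseteq> interior E"
  proof
    assume "- D \<subseteq> interior E"
    then have "UNIV \<subseteq> D \<union> E"
      using interior_subset by blast
    moreover have "bounded (D \<union> E)"
      using assms by (simp add: jordan_region_topology compact_imp_bounded)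
    ultimately show False
      using not_bounded_UNIV bounded_subset by blast
  qed
  ultimately show ?thesis by blast
qed

text \<open>Each open arc of the boundary of \<open>E\<close> misses the boundary of
  \<open>D\<close>, so it lies wholly inside or wholly outside \<open>D\<close>. Both inside would
  force \<open>E \<subseteq> D\<close>. Whether the boundaries cross or only touch at
  \<open>u\<close> and \<open>v\<close> is immaterial.\<close>

lemma frontier_position:
  assumes D: "jordan_region D" and E: "jordan_region E"
    and fin: "finite (frontier D \<inter> frontier E)" "card (frontier D \<inter> frontier E) \<le> 2"
    and "\<not> E \<subseteq> D"
  shows "connected (frontier E - interior D)"
    and "frontier E \<inter> interior D = {} \<or>
         connected (frontier E \<inter> D) \<and> frontier D \<inter> frontier E \<noteq> {}"
proof -
  obtain u v P Q where X: "frontier D \<inter> frontier E \<subseteq> {u, v}" and PQ: "frontier E = P \<union> Q" "P \<inter> Q = {u, v}"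
    and con: "connected P" "connected Q" "connected (P - {u, v})" "connected (Q - {u, v})"
    and cl: "P \<subseteq> closure (P - {u, v})" "Q \<subseteq> closure (Q - {u, v})"
    using jordan_region_frontier_arcs[OF E fin] by (metis inf_le2)
  have D_closed: "closed D"
    using D by (simp add: jordan_region_topology compact_imp_closed)
  have D_fr: "D = interior D \<union> frontier D" "interior D \<inter> frontier D = {}"
    using D_closed interior_subset by (auto simp: frontier_def)
  have inner: "A \<subseteq> D" if "A - {u, v} \<subseteq> interior D" "A \<subseteq> closure (A - {u, v})" for A
    using that D_closed by (meson closure_minimal interior_subset order_trans)
  have outer: "A \<inter> interior D = {}" if "(A - {u, v}) \<inter> D = {}" "A \<subseteq> closure (A - {u, v})" for A
  proof -
    have "(A - {u, v}) \<inter> interior D = {}"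
      using that interior_subset by blast
    then show ?thesis
      using that(2) open_Int_closure_eq_empty[of "interior D" "A - {u, v}"] by blast
  qed
  have dich: "A - {u, v} \<subseteq> interior D \<or> (A - {u, v}) \<inter> D = {}"
    if "connected (A - {u, v})" "A \<subseteq> frontier E" for A
    using that X by (intro connected_disjoint_frontier) auto
  have not_both: "\<not> (P - {u, v} \<subseteq> interior D \<and> Q - {u, v} \<subseteq> interior D)"
  proof
    assume "P - {u, v} \<subseteq> interior D \<and> Q - {u, v} \<subseteq> interior D"
    then have "frontier E \<subseteq> D"
      using inner[OF _ cl(1)] inner[OF _ cl(2)] by (simp add: PQ)
    then show False
      using frontier_subset_jordan_region[OF D E] \<open>\<not> E \<subseteq> D\<close> by simp
  qed
  have mixed: "connected (frontier E - interior D) \<and> connected (frontier E \<inter> D) \<and> frontier D \<inter> frontier E \<noteq> {}"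
    if "A - {u, v} \<subseteq> interior D" "(B - {u, v}) \<inter> D = {}" "A \<subseteq> closure (A - {u, v})" "B \<subseteq> closure (B - {u, v})"
       "connected A" "connected B" "frontier E = A \<union> B" "A \<inter> B = {u, v}" for A B
  proof -
    have AB: "A \<subseteq> D" "B \<inter> interior D = {}"
      using inner outer that by auto
    have uv: "u \<in> A" "u \<in> B" "v \<in> A" "v \<in> B"
      using that(8) by auto
    have "frontier E - interior D = B"
      using AB(2) uv that(1,7) by auto
    moreover have "frontier E \<inter> D = A"
      using AB(1) uv that(2,7) by auto
    moreover have "u \<in> frontier D"
      using AB uv D_fr(1) by auto
    moreover have "u \<in> frontier E"
      using uv that(7) by auto
    ultimately show ?thesis
      using that(5,6) by auto
  qed
  have dP: "P - {u, v} \<subseteq> interior D \<or> (P - {u, v}) \<inter> D = {}"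
    and dQ: "Q - {u, v} \<subseteq> interior D \<or> (Q - {u, v}) \<inter> D = {}"
    using dich[OF con(3)] dich[OF con(4)] PQ(1) by simp_all
  consider "(P - {u, v}) \<inter> D = {}" "(Q - {u, v}) \<inter> D = {}"
    | "P - {u, v} \<subseteq> interior D" "(Q - {u, v}) \<inter> D = {}"
    | "Q - {u, v} \<subseteq> interior D" "(P - {u, v}) \<inter> D = {}"
    using dP dQ not_both by metis
  then have "connected (frontier E - interior D) \<and> (frontier E \<inter> interior D = {} \<or>
         connected (frontier E \<inter> D) \<and> frontier D \<inter> frontier E \<noteq> {})"
  proof cases
    case 1
    then have "frontier E \<inter> interior D = {}"
      using outer[OF _ cl(1)] outer[OF _ cl(2)] by (simp add: PQ(1) Int_Un_distrib2)
    moreover have "connected (P \<union> Q)"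
      using con PQ by (intro connected_Un) auto
    ultimately show ?thesis
      using PQ by (metis Diff_triv)
  next
    case 2
    from mixed[OF this cl con(1,2) PQ] show ?thesis by simp
  next
    case 3
    from mixed[OF this cl(2,1) con(2,1)] PQ show ?thesis by (simp add: Un_commute Int_commute)
  qed
  then show "connected (frontier E - interior D)"
    and "frontier E \<inter> interior D = {} \<or>
         connected (frontier E \<inter> D) \<and> frontier D \<inter> frontier E \<noteq> {}"
    by auto
qed

text \<open>The set \<open>K\<close> collects the boundary pieces of \<open>E - interior D\<close>
  and is connected by the position of the two curves. Every component of
  \<open>interior E - D\<close> has a boundary point in \<open>K\<close>, so adding the closures of
  the components keeps the set connected.\<close>

lemma connected_jordan_region_diff_interior:
  assumes D: "jordan_region D" and E: "jordan_region E"
    and fin: "finite (frontier D \<inter> frontier E)" "card (frontier D \<inter> frontier E) \<le> 2"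
    and "\<not> D \<subseteq> E" "\<not> E \<subseteq> D"
  shows "connected (E - interior D)"
proof -
  have closed: "closed D" "closed E"
    using D E by (simp_all add: jordan_region_topology compact_imp_closed)
  have fr: "D = interior D \<union> frontier D" "E = interior E \<union> frontier E"
    "interior D \<inter> frontier D = {}" "interior E \<inter> frontier E = {}"
    using closed interior_subset by (auto simp: frontier_def)
  have bd: "bounded E"
    using E by (simp add: jordan_region_topology compact_imp_bounded)
  define K where "K = (frontier E - interior D) \<union> (frontier D \<inter> E)"
  note pos = frontier_position[OF D E fin \<open>\<not> E \<subseteq> D\<close>]
  have "frontier D \<inter> interior E = {} \<or> connected (frontier D \<inter> E) \<and> frontier D \<inter> frontier E \<noteq> {}"
    using frontier_position(2)[OF E D] fin \<open>\<not> D \<subseteq> E\<close> by (simp add: Int_commute)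
  then have K: "connected K"
  proof
    assume "frontier D \<inter> interior E = {}"
    then have "K = frontier E - interior D"
      using fr unfolding K_def by blast
    then show ?thesis using pos by simp
  next
    \<comment> \<open>A common boundary point belongs to both parts of \<open>K\<close> and links
      them.\<close>
    assume a: "connected (frontier D \<inter> E) \<and> frontier D \<inter> frontier E \<noteq> {}"
    have "(frontier E - interior D) \<inter> (frontier D \<inter> E) \<noteq> {}"
      using a fr by blast
    then show ?thesis
      unfolding K_def using a pos by (intro connected_Un) auto
  qed
  define U where "U = interior E - D"
  have U: "open U" "bounded U"
    unfolding U_def using closed bd interior_subset by (auto intro: bounded_subset)
  have clU: "closure U \<subseteq> E - interior D"
  proof -
    have "closure U \<subseteq> E"
      using closed closure_minimal interior_subset unfolding U_def by (metis Diff_subset order_trans)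
    moreover have "closure U \<inter> interior D = {}"
      using open_Int_closure_eq_empty[of "interior D" U] interior_subset unfolding U_def by blast
    ultimately show ?thesis by blast
  qed
  have comp: "connected (closure C)" "closure C \<subseteq> E - interior D" "closure C \<inter> K \<noteq> {}"
    if "C \<in> components U" for C
  proof -
    show "connected (closure C)"
      using that by (simp add: connected_imp_connected_closure in_components_connected)
    have "C \<subseteq> U"
      using that by (simp add: in_components_subset)
    then show sub: "closure C \<subseteq> E - interior D"
      using clU closure_mono by blast
    have "C \<noteq> {}" "C \<noteq> UNIV"
      using that \<open>C \<subseteq> U\<close> U not_bounded_UNIV bounded_subset in_components_nonempty by blast+
    then obtain y where y: "y \<in> frontier C"
      using frontier_not_empty by blast
    then have "y \<in> frontier U"
      using that frontier_of_components_subset by blast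
    then have "y \<notin> U"
      using U by (simp add: frontier_def interior_open)
    moreover have "y \<in> closure C"
      using y by (simp add: frontier_def)
    ultimately have "y \<in> K"
      using sub fr unfolding K_def U_def by blast
    then show "closure C \<inter> K \<noteq> {}"
      using \<open>y \<in> closure C\<close> by blast
  qed
  have "E - interior D = K \<union> \<Union> (closure ` components U)"
  proof
    have "E - interior D \<subseteq> K \<union> U"
      using fr unfolding K_def U_def by blast
    also have "U \<subseteq> \<Union> (closure ` components U)"
      using Union_components[of U] closure_subset by blast
    finally show "E - interior D \<subseteq> K \<union> \<Union> (closure ` components U)"
      by blast
    show "K \<union> \<Union> (closure ` components U) \<subseteq> E - interior D"
      using comp(2) fr unfolding K_def by blast
  qed
  also have "connected \<dots>"
    using K comp by (intro connected_Un_UN) (auto simp: Int_commute)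
  finally show ?thesis .
qed

text \<open>By Janiszewski's theorem, \<open>E\<close> and the complement of
  \<open>interior D\<close>, neither of which separates the plane, have a union that does not
  separate it if their intersection \<open>E - interior D\<close> is connected. The boundary points
  in \<open>D - E\<close> are added by closure.\<close>

lemma connected_jordan_region_diff:
  assumes D: "jordan_region D" and E: "jordan_region E"
    and fin: "finite (frontier D \<inter> frontier E)" "card (frontier D \<inter> frontier E) \<le> 2"
    and "\<not> D \<subseteq> E" "\<not> E \<subseteq> D"
  shows "connected (D - E)"
proof -
  have "connected (- (E \<union> - interior D))"
  proof (rule Janiszewski_connected)
    show "connected (E \<inter> - interior D)"
      using connected_jordan_region_diff_interior[OF assms] by (simp add: Diff_eq)
  qed (use D E in \<open>auto simp: jordan_region_topology\<close>)
  then have "connected (interior D - E)"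
    by (simp add: Diff_eq Int_commute)
  moreover have "D - E \<subseteq> closure (interior D - E)"
    using open_Int_closure_subset[of "- E" "interior D"] D E
    by (simp add: jordan_region_topology compact_imp_closed open_Compl Diff_eq Int_commute)
  moreover have "interior D - E \<subseteq> D - E"
    using interior_subset by blast
  ultimately show ?thesis
    using connected_intermediate_closure by blast
qed

text \<open>Inside \<open>D - E\<close>, up to an arbitrarily small neighbourhood, the ends of \<open>e\<close> can be joined
  by a path that misses \<open>f\<close>. Together with \<open>e\<close> it forms a loop close to \<open>D\<close>, and \<open>f\<close> starts
  and ends in the connected complement of \<open>D\<close>.\<close>

lemma isect_jordan_regions:
  assumes D: "jordan_region D" and E: "jordan_region E"
    and fin: "finite (frontier D \<inter> frontier E)" "card (frontier D \<inter> frontier E) \<le> 2"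
    and e: "path e" "path_image e \<subseteq> D" "pathstart e \<notin> E" "pathfinish e \<notin> E"
    and f: "path f" "path_image f \<subseteq> E" "pathstart f \<notin> D" "pathfinish f \<notin> D"
  shows "isect e f = 0"
proof -
  have nsub: "\<not> D \<subseteq> E" "\<not> E \<subseteq> D"
    using e f pathstart_in_path_image by blast+
  have "open (- D)" "connected (- D)" and E_open: "open (- E)"
    using D E by (auto simp: jordan_region_topology compact_imp_closed)
  then have "path_connected (- D)"
    by (simp add: connected_open_path_connected)
  then obtain g where g: "path g" "path_image g \<subseteq> - D" "pathstart g = pathstart f" "pathfinish g = pathfinish f"
    using f unfolding path_connected_def by blast
  \<comment> \<open>Avoiding \<open>E\<close> keeps the new path off \<open>f\<close>; avoiding
    \<open>g\<close> keeps both ends of \<open>f\<close> in one component of the complement of the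
    loop.\<close>
  define W where "W = - path_image g \<inter> - E"
  have "open W"
    unfolding W_def using g E_open by (simp add: closed_path_image open_Int open_Compl)
  have "connected_component W (pathstart e) (pathfinish e)"
    unfolding connected_component_def
  proof (intro exI conjI)
    show "connected (D - E)"
      by (rule connected_jordan_region_diff[OF D E fin nsub])
    show "D - E \<subseteq> W"
      using g(2) by (auto simp: W_def)
    show "pathstart e \<in> D - E" "pathfinish e \<in> D - E"
      using e pathstart_in_path_image[of e] pathfinish_in_path_image[of e] by blast+
  qed
  then have "path_component W (pathstart e) (pathfinish e)"
    using \<open>open W\<close> by (simp add: open_path_connected_component)
  then obtain e' where e': "path e'" "path_image e' \<subseteq> W" "pathstart e' = pathstart e" "pathfinish e' = pathfinish e"
    unfolding path_component_def by blast
  have disj: "path_image e' \<inter> path_image f = {}"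
    using e' f unfolding W_def by blast
  have apart: "ends_apart e f" "ends_apart (reversepath e') f"
    using e f ends_apart_disjoint[OF e'(1) f(1) disj]
    by (auto simp: ends_apart_reversepath) (auto simp: ends_apart_def)
  define L where "L = e +++ reversepath e'"
  have "isect L f = isect e f + isect (reversepath e') f"
    unfolding L_def using apart e' by (intro isect_join) auto
  moreover have "isect (reversepath e') f = 0"
    using e' f disj by (intro isect_disjoint) auto
  moreover have "isect L f = 0"
  proof -
    have "path_image g \<inter> path_image L = {}"
      using e e' g unfolding L_def W_def by (auto simp: path_image_join)
    then have "winding_number L (pathstart f) = winding_number L (pathfinish f)"
      using g e e' pathstart_in_path_image[of g] pathfinish_in_path_image[of g] connected_path_image[of g]
      by (intro winding_number_eq[where S = "path_image g"]) (auto simp: L_def)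
    then show ?thesis
      using e' by (simp add: isect_def L_def)
  qed
  ultimately show ?thesis by simp
qed

subsection \<open>Delaunay graphs of pseudo-discs\<close>

definition port :: "'a set set \<Rightarrow> 'a set set \<Rightarrow> 'a set" where
  "port A U = \<Union>U - \<Union>(A - U)"

text \<open>That the ends of a piece lie in no region outside \<open>U\<close> is what makes the pieces of disjoint
  families have intersection number \<open>0\<close>.\<close>

definition piece :: "complex set set \<Rightarrow> complex set set \<Rightarrow> complex set set \<Rightarrow> (real \<Rightarrow> complex) \<Rightarrow> bool" where
  "piece A B U \<gamma> \<longleftrightarrow> path \<gamma> \<and> pathstart \<gamma> \<in> port A U \<and> pathfinish \<gamma> \<in> port A U \<and>
     ((\<exists>a\<in>U. path_image \<gamma> \<subseteq> a) \<or> (\<exists>b\<in>B. b \<inter> \<Union>(A - U) = {} \<and> path_image \<gamma> \<subseteq> b))"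

text \<open>Not only the ends but also all junctions lie in the port, so additivity of
  \<open>isect\<close> applies at each junction.\<close>

inductive good_path :: "complex set set \<Rightarrow> complex set set \<Rightarrow> complex set set \<Rightarrow> (real \<Rightarrow> complex) \<Rightarrow> bool"
  for A B U where
  piece: "piece A B U \<gamma> \<Longrightarrow> good_path A B U \<gamma>"
| join: "good_path A B U \<gamma> \<Longrightarrow> good_path A B U \<delta> \<Longrightarrow> pathfinish \<gamma> = pathstart \<delta> \<Longrightarrow> good_path A B U (\<gamma> +++ \<delta>)"

lemma port_mono: "U \<subseteq> U' \<Longrightarrow> port A U \<subseteq> port A U'"
  by (auto simp: port_def)

lemma piece_avoids_port:
  assumes "piece A B U \<gamma>" "U \<subseteq> A" "W \<subseteq> A" "U \<inter> W = {}" "z \<in> port A W"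
  shows "z \<notin> path_image \<gamma>"
proof -
  have z: "z \<in> \<Union>W" "z \<notin> \<Union>(A - W)"
    using assms(5) by (auto simp: port_def)
  have sub: "W \<subseteq> A - U" "U \<subseteq> A - W"
    using assms by auto
  have zU: "z \<in> \<Union>(A - U)" "z \<notin> \<Union>U"
    using z Union_mono[OF sub(1)] Union_mono[OF sub(2)] by auto
  show ?thesis
    using assms(1) unfolding piece_def
  proof (elim conjE disjE bexE)
    fix a assume "a \<in> U" "path_image \<gamma> \<subseteq> a"
    then show ?thesis using zU(2) by auto
  next
    fix b assume "b \<inter> \<Union>(A - U) = {}" "path_image \<gamma> \<subseteq> b"
    then show ?thesis using zU(1) by auto
  qed
qed

lemma good_path_ends:
  assumes "good_path A B U \<gamma>"
  shows "path \<gamma> \<and> pathstart \<gamma> \<in> port A U \<and> pathfinish \<gamma> \<in> port A U"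
  using assms by (induction rule: good_path.induct) (auto simp: piece_def)

lemma good_path_avoids_port:
  assumes "good_path A B U \<gamma>" "U \<subseteq> A" "W \<subseteq> A" "U \<inter> W = {}" "z \<in> port A W"
  shows "z \<notin> path_image \<gamma>"
  using assms(1)
proof (induction rule: good_path.induct)
  case (piece \<gamma>)
  then show ?case using piece_avoids_port assms(2-) by metis
next
  case (join \<gamma> \<delta>)
  then show ?case by (simp add: path_image_join)
qed

lemma good_path_ends_apart:
  assumes "good_path A B U \<gamma>" "good_path A B W \<delta>" "U \<subseteq> A" "W \<subseteq> A" "U \<inter> W = {}"
  shows "ends_apart \<gamma> \<delta>"
proof -
  have "W \<inter> U = {}"
    using assms(5) by auto
  then show ?thesis
    using good_path_ends[OF assms(1)] good_path_ends[OF assms(2)] assms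
      good_path_avoids_port[OF assms(1,3,4,5)] good_path_avoids_port[OF assms(2,4,3)]
    by (simp add: ends_apart_def)
qed

lemma pseudo_discs_isect:
  assumes "pseudo_discs F" "D \<in> F" "E \<in> F" "D \<noteq> E"
    "path e" "path_image e \<subseteq> D" "pathstart e \<notin> E" "pathfinish e \<notin> E"
    "path f" "path_image f \<subseteq> E" "pathstart f \<notin> D" "pathfinish f \<notin> D"
  shows "isect e f = 0"
  using assms by (intro isect_jordan_regions[of D E]) (auto simp: pseudo_discs_def)

text \<open>Two regions, or two connectors, are distinct members of one pseudo-disc family, and the
  ports keep the ends of each piece outside the other's set. A region and a connector of the other
  side are disjoint.\<close>

lemma piece_isect:
  assumes AB: "pseudo_discs A" "pseudo_discs B" and UW: "U \<subseteq> A" "W \<subseteq> A" "U \<inter> W = {}"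
    and \<gamma>: "piece A B U \<gamma>" and \<delta>: "piece A B W \<delta>"
  shows "isect \<gamma> \<delta> = 0"
proof -
  have sub: "W \<subseteq> A - U" "U \<subseteq> A - W"
    using UW by auto
  have \<gamma>': "path \<gamma>" "pathstart \<gamma> \<in> \<Union>U" "pathfinish \<gamma> \<in> \<Union>U" "pathstart \<gamma> \<notin> \<Union>W" "pathfinish \<gamma> \<notin> \<Union>W"
    and \<delta>': "path \<delta>" "pathstart \<delta> \<in> \<Union>W" "pathfinish \<delta> \<in> \<Union>W" "pathstart \<delta> \<notin> \<Union>U" "pathfinish \<delta> \<notin> \<Union>U"
    using \<gamma> \<delta> Union_mono[OF sub(1)] Union_mono[OF sub(2)] by (auto simp: piece_def port_def)
  consider (regions) a a' where "a \<in> U" "path_image \<gamma> \<subseteq> a" "a' \<in> W" "path_image \<delta> \<subseteq> a'"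
    | (region_conn) a b' where "a \<in> U" "path_image \<gamma> \<subseteq> a" "b' \<in> B" "b' \<inter> \<Union>(A - W) = {}" "path_image \<delta> \<subseteq> b'"
    | (conn_region) b a' where "b \<in> B" "b \<inter> \<Union>(A - U) = {}" "path_image \<gamma> \<subseteq> b" "a' \<in> W" "path_image \<delta> \<subseteq> a'"
    | (conns) b b' where "b \<in> B" "b \<inter> \<Union>(A - U) = {}" "path_image \<gamma> \<subseteq> b"
        "b' \<in> B" "b' \<inter> \<Union>(A - W) = {}" "path_image \<delta> \<subseteq> b'"
    using \<gamma> \<delta> unfolding piece_def by metis
  then show ?thesis
  proof cases
    case regions
    then have "a \<noteq> a'" "a \<in> A" "a' \<in> A"
      using UW by auto
    then show ?thesis
      using regions \<gamma>' \<delta>' by (intro pseudo_discs_isect[OF AB(1), of a a']) auto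
  next
    case region_conn
    then have "path_image \<gamma> \<inter> path_image \<delta> = {}"
      using sub(2) by fastforce
    then show ?thesis
      using \<gamma>' \<delta>' by (intro isect_disjoint)
  next
    case conn_region
    then have "path_image \<gamma> \<inter> path_image \<delta> = {}"
      using sub(1) by fastforce
    then show ?thesis
      using \<gamma>' \<delta>' by (intro isect_disjoint)
  next
    case conns
    have nb: "z \<notin> b" if "z \<in> \<Union>W" for z
      using conns(2) subsetD[OF Union_mono[OF sub(1)] that] by (simp only: disjoint_iff) metis
    have nb': "z \<notin> b'" if "z \<in> \<Union>U" for z
      using conns(5) subsetD[OF Union_mono[OF sub(2)] that] by (simp only: disjoint_iff) metis
    have "b \<noteq> b'"
      using nb' \<gamma>'(2) conns(3) pathstart_in_path_image[of \<gamma>] by auto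
    then show ?thesis
      using conns \<gamma>' \<delta>' nb nb' by (intro pseudo_discs_isect[OF AB(2), of b b']) auto
  qed
qed

lemma good_path_isect:
  assumes AB: "pseudo_discs A" "pseudo_discs B" and UW: "U \<subseteq> A" "W \<subseteq> A" "U \<inter> W = {}"
    and \<gamma>: "good_path A B U \<gamma>" and \<delta>: "good_path A B W \<delta>"
  shows "isect \<gamma> \<delta> = 0"
  using \<gamma>
proof (induction rule: good_path.induct)
  case (piece \<gamma>)
  have g: "good_path A B U \<gamma>"
    using piece by (rule good_path.piece)
  have "isect \<delta> \<gamma> = 0"
    using \<delta>
  proof (induction rule: good_path.induct)
    case (piece \<delta>)
    then show ?case
      using piece_isect[OF AB UW \<open>piece A B U \<gamma>\<close>] isect_commute[of \<delta> \<gamma>] by simp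
  next
    case (join \<delta> \<delta>')
    then have "ends_apart \<delta> \<gamma>" "ends_apart \<delta>' \<gamma>"
      using good_path_ends_apart[OF g _ UW] by (simp_all add: ends_apart_commute)
    then show ?case
      using join by (simp add: isect_join)
  qed
  then show ?case
    using isect_commute[of \<gamma> \<delta>] by simp
next
  case (join \<gamma> \<gamma>')
  then have "ends_apart \<gamma> \<delta>" "ends_apart \<gamma>' \<delta>"
    using good_path_ends_apart[OF _ \<delta> UW] by simp_all
  then show ?case
    using join by (simp add: isect_join)
qed

definition delaunay :: "'a set set \<Rightarrow> 'a set set \<Rightarrow> 'a set \<Rightarrow> 'a set \<Rightarrow> bool" where
  "delaunay A B a a' \<longleftrightarrow> a \<noteq> a' \<and> (\<exists>b\<in>B. {x \<in> A. x \<inter> b \<noteq> {}} = {a, a'})"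

lemma symp_delaunay: "symp (delaunay A B)"
  by (auto simp: symp_def delaunay_def insert_commute)

lemma delaunay_witness:
  assumes "delaunay A B a a'"
  obtains b where "b \<in> B" "a \<inter> b \<noteq> {}" "a' \<inter> b \<noteq> {}" "a \<in> A" "a' \<in> A"
    "\<And>U. {a, a'} \<subseteq> U \<Longrightarrow> b \<inter> \<Union>(A - U) = {}"
proof -
  obtain b where b: "b \<in> B" "{x \<in> A. x \<inter> b \<noteq> {}} = {a, a'}"
    using assms unfolding delaunay_def by blast
  have "b \<inter> \<Union>(A - U) = {}" if "{a, a'} \<subseteq> U" for U
  proof -
    have "x \<inter> b = {}" if x: "x \<in> A - U" for x
    proof (rule ccontr)
      assume "x \<inter> b \<noteq> {}"
      then have "x \<in> {x \<in> A. x \<inter> b \<noteq> {}}"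
        using x by simp
      then show False
        using \<open>{a, a'} \<subseteq> U\<close> x unfolding b(2) by auto
    qed
    then show ?thesis by auto
  qed
  moreover have "a \<in> {x \<in> A. x \<inter> b \<noteq> {}}" "a' \<in> {x \<in> A. x \<inter> b \<noteq> {}}"
    using b(2) by simp_all
  ultimately show thesis
    using that[of b] b(1) by simp
qed

text \<open>Follow a walk in the Delaunay graph, alternating between regions and connectors. The
  changeover points lie on a connector that misses all regions outside \<open>U\<close>, so they
  belong to the port.\<close>

lemma good_path_exists:
  assumes AB: "pseudo_discs A" "pseudo_discs B" and "U \<subseteq> A"
    and "(a, a') \<in> {(p, q). p \<in> U \<and> q \<in> U \<and> delaunay A B p q}\<^sup>*"
    and "a \<in> U" "x \<in> a \<inter> port A U" "y \<in> a' \<inter> port A U"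
  shows "\<exists>\<gamma>. good_path A B U \<gamma> \<and> pathstart \<gamma> = x \<and> pathfinish \<gamma> = y"
  using assms(4,7)
proof (induction arbitrary: y rule: rtrancl_induct)
  case base
  have "jordan_region a"
    using AB \<open>U \<subseteq> A\<close> \<open>a \<in> U\<close> by (auto simp: pseudo_discs_def)
  then obtain g where g: "path g" "path_image g \<subseteq> a" "pathstart g = x" "pathfinish g = y"
    using jordan_region_path_connected[of a] base assms(6) unfolding path_connected_def by blast
  then have "piece A B U g"
    using base assms(5,6) unfolding piece_def by auto
  then show ?case
    using g good_path.piece by blast
next
  case (step c d)
  then have cd: "c \<in> U" "d \<in> U" "delaunay A B c d"
    by auto
  obtain b where b: "b \<in> B" "c \<inter> b \<noteq> {}" "d \<inter> b \<noteq> {}" "b \<inter> \<Union>(A - U) = {}"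
    using delaunay_witness[OF cd(3)] cd(1,2) by (metis empty_subsetI insert_subset)
  obtain z w where zw: "z \<in> c" "z \<in> b" "w \<in> d" "w \<in> b"
    using b by blast
  have port: "z \<in> port A U" "w \<in> port A U"
    using zw b(4) cd by (auto simp: port_def)
  obtain \<gamma> where \<gamma>: "good_path A B U \<gamma>" "pathstart \<gamma> = x" "pathfinish \<gamma> = z"
    using step.IH[of z] zw port by blast
  have "jordan_region b" "jordan_region d"
    using AB b cd \<open>U \<subseteq> A\<close> by (auto simp: pseudo_discs_def)
  note pc = this[THEN jordan_region_path_connected]
  obtain g where g: "path g" "path_image g \<subseteq> b" "pathstart g = z" "pathfinish g = w"
    using pc(1) zw unfolding path_connected_def by blast
  then have "piece A B U g"
    using port b unfolding piece_def by auto
  then have g': "good_path A B U g"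
    by (rule good_path.piece)
  obtain h where h: "path h" "path_image h \<subseteq> d" "pathstart h = w" "pathfinish h = y"
    using pc(2) zw step.prems unfolding path_connected_def by blast
  then have "piece A B U h"
    using port cd step.prems unfolding piece_def by auto
  then have h': "good_path A B U h"
    by (rule good_path.piece)
  have "good_path A B U ((\<gamma> +++ g) +++ h)"
    using \<gamma> g g' h h' by (intro good_path.join) auto
  then show ?case
    using \<gamma> g h by (intro exI[of _ "(\<gamma> +++ g) +++ h"]) simp
qed

text \<open>Vertices are drawn in the ports and the edge from \<open>i\<close> to \<open>j\<close>
  runs through \<open>U i \<union> U j\<close>. Independent edges then use disjoint families, so
  their intersection numbers vanish, contradicting \<open>k5_crossing\<close>.\<close>

lemma no_k5_model:
  assumes AB: "pseudo_discs A" "pseudo_discs B"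
    and U: "\<And>i. i < 5 \<Longrightarrow> U i \<subseteq> A" "\<And>i. i < 5 \<Longrightarrow> port A (U i) \<noteq> {}"
    and disj: "\<And>i j. \<lbrakk>i < 5; j < 5; i \<noteq> j\<rbrakk> \<Longrightarrow> U i \<inter> U j = {}"
    and conn: "\<And>i j. \<lbrakk>i < j; j < (5::nat)\<rbrakk> \<Longrightarrow> conn_in (delaunay A B) (U i \<union> U j)"
  shows False
proof -
  define v where "v = (\<lambda>i. SOME z. z \<in> port A (U i))"
  have v: "v i \<in> port A (U i)" if "i < 5" for i
    using U(2)[OF that] by (simp add: v_def some_in_eq)
  have "\<exists>\<gamma>. good_path A B (U i \<union> U j) \<gamma> \<and> pathstart \<gamma> = v i \<and> pathfinish \<gamma> = v j"
    if ij: "i < j" "j < 5" for i j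
  proof -
    have vv: "v i \<in> port A (U i \<union> U j)" "v j \<in> port A (U i \<union> U j)"
      using v[of i] v[of j] ij port_mono[of "U i" "U i \<union> U j"] port_mono[of "U j" "U i \<union> U j"] by auto
    obtain a a' where a: "a \<in> U i" "v i \<in> a" "a' \<in> U j" "v j \<in> a'"
      using v[of i] v[of j] ij by (auto simp: port_def)
    have "(a, a') \<in> {(p, q). p \<in> U i \<union> U j \<and> q \<in> U i \<union> U j \<and> delaunay A B p q}\<^sup>*"
      using conn[OF ij] a unfolding conn_in_def by simp
    then show ?thesis
      using good_path_exists[OF AB, of "U i \<union> U j" a a' "v i" "v j"] U(1)[of i] U(1)[of j] ij a vv by simp
  qed
  then obtain e where e: "\<And>i j. \<lbrakk>i < j; j < 5\<rbrakk> \<Longrightarrow> good_path A B (U i \<union> U j) (e i j)"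
      "\<And>i j. \<lbrakk>i < j; j < 5\<rbrakk> \<Longrightarrow> pathstart (e i j) = v i" "\<And>i j. \<lbrakk>i < j; j < 5\<rbrakk> \<Longrightarrow> pathfinish (e i j) = v j"
    by metis
  have e_path: "path (e i j)" if "i < j" "j < 5" for i j
    using good_path_ends[OF e(1)[OF that]] by simp
  have "k5_drawing v e"
    unfolding k5_drawing_def
  proof (intro allI impI conjI; elim conjE)
    fix i j k :: nat assume ijk: "i < j" "j < 5" "k < 5" "k \<noteq> i" "k \<noteq> j"
    then have "(U i \<union> U j) \<inter> U k = {}"
      using disj[of i k] disj[of j k] by auto
    then show "v k \<notin> path_image (e i j)"
      using good_path_avoids_port[OF e(1)[OF ijk(1,2)], of "U k"] U(1)[of i] U(1)[of j] U(1)[of k] v[of k] ijk by simp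
  qed (simp_all add: e e_path)
  then obtain i j k l where ijkl: "i < j" "j < 5" "k < l" "l < 5" "distinct [i, j, k, l]" "isect (e i j) (e k l) \<noteq> 0"
    using k5_crossing by blast
  have "(U i \<union> U j) \<inter> (U k \<union> U l) = {}"
    using disj[of i k] disj[of i l] disj[of j k] disj[of j l] ijkl by (simp add: Int_Un_distrib Int_Un_distrib2)
  then have "isect (e i j) (e k l) = 0"
    using good_path_isect[OF AB _ _ _ e(1)[OF ijkl(1,2)] e(1)[OF ijkl(3,4)]] U(1)[of i] U(1)[of j] U(1)[of k] U(1)[of l] ijkl
    by simp
  then show False
    using ijkl by simp
qed

text \<open>Merging the branch sets of a \<open>K\<^sub>1\<^sub>0\<close> model in pairs makes every branch set contain an edge, hence a port.\<close>

lemma delaunay_linear: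
  assumes AB: "pseudo_discs A" "pseudo_discs B" and "finite A" "A \<noteq> {}"
  shows "card {(a, a'). delaunay A B a a'} < 2 ^ 10 * card A"
proof (rule ccontr)
  let ?E = "delaunay A B"
  define P where "P = (\<lambda>a. {a}) ` A"
  have inA: "a \<in> A \<and> a' \<in> A \<and> a \<noteq> a'" if "?E a a'" for a a'
  proof -
    have "a \<noteq> a'" using that by (simp add: delaunay_def)
    then show ?thesis using delaunay_witness[OF that] by metis
  qed
  assume "\<not> card {(a, a'). ?E a a'} < 2 ^ 10 * card A"
  moreover have "touching_pairs ?E P = (\<lambda>(a, a'). ({a}, {a'})) ` {(a, a'). ?E a a'}"
    using inA by (auto simp: touching_pairs_def P_def touch_def)
  then have "card (touching_pairs ?E P) = card {(a, a'). ?E a a'}"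
    by (simp add: card_image inj_on_def split_def prod_eq_iff)
  moreover have "card P = card A"
    by (simp add: P_def card_image)
  ultimately have "2 ^ 10 * card P \<le> card (touching_pairs ?E P)"
    by simp
  moreover have "finite P" "P \<noteq> {}" "{} \<notin> P" "disjoint P" "\<And>X. X \<in> P \<Longrightarrow> conn_in ?E X"
    using assms by (auto simp: P_def disjoint_def conn_in_singleton)
  ultimately have "\<exists>Q. complete_model ?E P 10 Q"
    using symp_delaunay by (intro complete_minor)
  then obtain Q where "complete_model ?E P 10 Q" ..
  then have Q: "finite Q" "card Q = 10" "disjoint Q" "\<Union>Q \<subseteq> \<Union>P" "\<And>q. q \<in> Q \<Longrightarrow> conn_in ?E q"
      "\<And>q q'. \<lbrakk>q \<in> Q; q' \<in> Q; q \<noteq> q'\<rbrakk> \<Longrightarrow> touch ?E q q'"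
    unfolding complete_model_def by auto
  obtain h where h: "bij_betw h {0..<10::nat} Q"
    using ex_bij_betw_nat_finite[OF Q(1)] Q(2) by auto
  have hQ: "h i \<in> Q" if "i < 10" for i
    using h that by (auto simp: bij_betw_def)
  have h_inj: "h i \<noteq> h j" if "i < 10" "j < 10" "i \<noteq> j" for i j
    using h that by (auto simp: bij_betw_def inj_on_def)
  have h_disj: "h i \<inter> h j = {}" if "i < 10" "j < 10" "i \<noteq> j" for i j
    using Q(3) hQ h_inj that by (auto simp: disjoint_def)
  have h_touch: "touch ?E (h i) (h j)" if "i < 10" "j < 10" "i \<noteq> j" for i j
    using Q(6) hQ h_inj that by auto
  have hA: "h i \<subseteq> A" if "i < 10" for i
    using Q(4) hQ[OF that] by (auto simp: P_def)
  define U where "U = (\<lambda>i. h (2 * i) \<union> h (Suc (2 * i)))"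
  show False
  proof (rule no_k5_model[OF AB, of U])
    fix i :: nat assume i: "i < 5"
    then have i': "2 * i < 10" "Suc (2 * i) < 10"
      by simp_all
    show "U i \<subseteq> A"
      using hA i' by (simp add: U_def)
    \<comment> \<open>The edge between the two merged branch sets has a connector that misses all
      regions outside \<open>U i\<close>; any point where it meets \<open>a\<close> is in the
      port.\<close>
    obtain a a' where a: "a \<in> U i" "a' \<in> U i" "?E a a'"
      using h_touch[OF i'] by (auto simp: touch_def U_def)
    obtain b where b: "b \<in> B" "a \<inter> b \<noteq> {}" "b \<inter> \<Union>(A - U i) = {}"
      using delaunay_witness[OF a(3)] a by (metis empty_subsetI insert_subset)
    then obtain x where "x \<in> a" "x \<in> b"
      by auto
    then have "x \<in> port A (U i)"
      using a b by (auto simp: port_def)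
    then show "port A (U i) \<noteq> {}" by auto
  next
    fix i j :: nat assume ij: "i < 5" "j < 5" "i \<noteq> j"
    have "2 * i \<noteq> Suc (2 * j)" "Suc (2 * i) \<noteq> 2 * j"
      by presburger+
    then show "U i \<inter> U j = {}"
      unfolding U_def using ij h_disj by (simp add: Int_Un_distrib Int_Un_distrib2)
  next
    fix i j :: nat assume ij: "i < j" "j < 5"
    have conn: "conn_in ?E (U k)" if "k < 5" for k
      unfolding U_def using that by (intro conn_in_Un[OF symp_delaunay] Q(5) hQ h_touch) auto
    have "touch ?E (h (2 * i)) (h (2 * j))"
      using ij by (intro h_touch) auto
    then have "touch ?E (U i) (U j)"
      by (auto simp: touch_def U_def)
    then show "conn_in ?E (U i \<union> U j)"
      using ij conn by (intro conn_in_Un[OF symp_delaunay]) auto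
  qed
qed

text \<open>Only the small traces matter: singleton traces give every region a port, and traces of
  size two make the five regions pairwise Delaunay neighbours.\<close>

lemma no_shattered_5:
  assumes AB: "pseudo_discs A" "pseudo_discs B" and X: "X \<subseteq> A" "finite X" "card X = 5"
  shows "\<exists>Y\<subseteq>X. \<forall>b\<in>B. {x \<in> X. x \<inter> b \<noteq> {}} \<noteq> Y"
proof (rule ccontr)
  assume "\<not> ?thesis"
  then have sh: "\<exists>b\<in>B. {x \<in> X. x \<inter> b \<noteq> {}} = Y" if "Y \<subseteq> X" for Y
    using that by meson
  have X': "pseudo_discs X"
    using AB(1) X(1) unfolding pseudo_discs_def by (meson subsetD)
  obtain h where h: "bij_betw h {0..<5::nat} X"
    using ex_bij_betw_nat_finite[OF X(2)] X(3) by auto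
  have hX: "h i \<in> X" if "i < 5" for i
    using h that by (auto simp: bij_betw_def)
  have h_inj: "h i \<noteq> h j" if "i < 5" "j < 5" "i \<noteq> j" for i j
    using h that by (auto simp: bij_betw_def inj_on_def)
  show False
  proof (rule no_k5_model[OF X' AB(2), of "\<lambda>i. {h i}"])
    fix i :: nat assume i: "i < 5"
    show "{h i} \<subseteq> X"
      using hX[OF i] by simp
    obtain b where b: "{x \<in> X. x \<inter> b \<noteq> {}} = {h i}"
      using sh[of "{h i}"] hX[OF i] by auto
    have "h i \<in> {x \<in> X. x \<inter> b \<noteq> {}}"
      unfolding b by simp
    then have "h i \<inter> b \<noteq> {}"
      by simp
    then obtain z where z: "z \<in> h i" "z \<in> b"
      by auto
    have "z \<notin> x" if x: "x \<in> X - {h i}" for x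
    proof
      assume "z \<in> x"
      then have "x \<in> {x \<in> X. x \<inter> b \<noteq> {}}"
        using x z by auto
      then show False
        using x unfolding b by simp
    qed
    then have "z \<in> port X {h i}"
      using z by (auto simp: port_def)
    then show "port X {h i} \<noteq> {}" by auto
  next
    fix i j :: nat assume "i < 5" "j < 5" "i \<noteq> j"
    then show "{h i} \<inter> {h j} = {}"
      using h_inj by auto
  next
    fix i j :: nat assume ij: "i < j" "j < 5"
    have "delaunay X B (h i) (h j)"
      using sh[of "{h i, h j}"] hX[of i] hX[of j] h_inj[of i j] ij by (auto simp: delaunay_def)
    then have "touch (delaunay X B) {h i} {h j}"
      by (simp add: touch_def)
    then show "conn_in (delaunay X B) ({h i} \<union> {h j})"
      by (intro conn_in_Un[OF symp_delaunay] conn_in_singleton)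
  qed
qed

subsection \<open>Counting intersections\<close>

text \<open>The outer \<open>64 * t\<close> comes from \<open>card_heavy_members\<close>; the inner
  factor is the bound of \<open>card_shallow_members\<close> with \<open>c = 2 ^ 10\<close> and
  \<open>k = 64 * t\<close>.\<close>

definition degree_bound :: "nat \<Rightarrow> nat" where
  "degree_bound t = 64 * t * (t * (4 * 2 ^ 10 * (64 * t) + 2) ^ 4)"

lemma pseudo_discs_subset: "pseudo_discs G \<Longrightarrow> F \<subseteq> G \<Longrightarrow> pseudo_discs F"
  unfolding pseudo_discs_def by (meson subsetD)

text \<open>If all members of \<open>B\<close> had degree at least
  \<open>degree_bound t + 1\<close>, counting them as heavy at that threshold would give
  \<open>card B * (degree_bound t + 1) \<le> degree_bound t * card A\<close>, impossible when
  \<open>A\<close> is nonempty and not larger than \<open>B\<close>.\<close>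

lemma light_member:
  assumes AB: "pseudo_discs A" "pseudo_discs B" "finite A" "finite B" and "A \<noteq> {}" "card A \<le> card B" "t \<ge> 1"
    and free: "\<And>X Y. \<lbrakk>X \<subseteq> A; Y \<subseteq> B; card X = t; card Y = t\<rbrakk> \<Longrightarrow> \<exists>x\<in>X. \<exists>y\<in>Y. x \<inter> y = {}"
  shows "\<exists>b\<in>B. card {a \<in> A. a \<inter> b \<noteq> {}} \<le> degree_bound t"
proof (rule ccontr)
  assume no: "\<not> ?thesis"
  define N where "N = (\<lambda>b::complex set. {x. x \<inter> b \<noteq> {}})"
  define q where "q = t * (4 * 2 ^ 10 * (64 * t) + 2) ^ 4"
  have N_Int: "N b \<inter> S = {x \<in> S. x \<inter> b \<noteq> {}}" for b S
    by (auto simp: N_def)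
  have lin: "card (exact_pairs B N S) \<le> 2 ^ 10 * card S" if "S \<subseteq> A" for S
  proof (cases "S = {}")
    case True
    then show ?thesis by (simp add: exact_pairs_def)
  next
    case False
    have "exact_pairs B N S = {(a, a'). delaunay S B a a'}"
      unfolding exact_pairs_def delaunay_def N_Int ..
    then show ?thesis
      using delaunay_linear[of S B] pseudo_discs_subset[OF AB(1) that] AB finite_subset[OF that] False by simp
  qed
  have vc: "\<exists>Y\<subseteq>X. \<forall>b\<in>B. N b \<inter> X \<noteq> Y" if "X \<subseteq> A" "card X = 5" for X
    using no_shattered_5[OF AB(1,2) that(1) _ that(2)] finite_subset[OF that(1) AB(3)] unfolding N_Int by simp
  have mult: "card {b \<in> B. X \<subseteq> N b} \<le> t" if X: "X \<subseteq> A" "card X = t" for X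
  proof (rule ccontr)
    assume "\<not> ?thesis"
    then have "t \<le> card {b \<in> B. X \<subseteq> N b}"
      by simp
    then obtain Y where Y: "Y \<subseteq> {b \<in> B. X \<subseteq> N b}" "card Y = t"
      using obtain_subset_with_card_n by metis
    have "\<exists>x\<in>X. \<exists>y\<in>Y. x \<inter> y = {}"
      using Y by (intro free X) auto
    then obtain x y where xy: "x \<in> X" "y \<in> Y" "x \<inter> y = {}"
      by auto
    have "x \<in> N y"
      using xy Y(1) by auto
    then show False
      using xy by (simp add: N_def)
  qed
  have "card {b \<in> B. t \<le> card (N b \<inter> S) \<and> card (N b \<inter> S) \<le> 64 * t \<and> N b \<inter> S \<noteq> {}} \<le> q * card S"
    if S: "S \<subseteq> A" for S
    unfolding q_def
  proof (rule card_shallow_members)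
    show "finite S" "finite B" "1 \<le> 64 * t"
      using AB S finite_subset \<open>t \<ge> 1\<close> by auto
    show "card (exact_pairs B N S') \<le> 2 ^ 10 * card S'" if "S' \<subseteq> S" for S'
      using that S by (intro lin) auto
    show "\<exists>Y\<subseteq>X. \<forall>b\<in>B. N b \<inter> X \<noteq> Y" if "X \<subseteq> S" "card X = 5" for X
      using that S by (intro vc) auto
    show "card {b \<in> B. X \<subseteq> N b} \<le> t" if "X \<subseteq> S" "card X = t" for X
      using that S by (intro mult) auto
  qed
  note heavy = card_heavy_members[OF AB(3,4) \<open>t \<ge> 1\<close> _ this]
  have K: "degree_bound t = 64 * t * q"
    by (simp add: degree_bound_def q_def)
  have "q \<ge> 1"
    using \<open>t \<ge> 1\<close> by (simp add: q_def)
  then have "64 * t * 1 \<le> 64 * t * q"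
    by (intro mult_left_mono) auto
  then have "16 * t \<le> Suc (degree_bound t)"
    unfolding K by linarith
  then have "card {b \<in> B. Suc (degree_bound t) \<le> card (N b \<inter> A)} * Suc (degree_bound t) \<le> degree_bound t * card A"
    unfolding K by (rule heavy)
  moreover have "{b \<in> B. Suc (degree_bound t) \<le> card (N b \<inter> A)} = B"
    using no unfolding N_Int by (auto simp: not_le)
  ultimately have "card B * Suc (degree_bound t) \<le> card A * degree_bound t"
    by (simp add: mult.commute)
  moreover have "card A * Suc (degree_bound t) \<le> card B * Suc (degree_bound t)"
    using \<open>card A \<le> card B\<close> by (rule mult_le_mono1)
  ultimately have "card A * Suc (degree_bound t) \<le> card A * degree_bound t"
    by (rule order_trans[rotated])
  then show False
    using \<open>A \<noteq> {}\<close> AB(3) by simp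
qed

text \<open>The hypotheses are symmetric in \<open>A\<close> and \<open>B\<close> and pass to
  subfamilies, so a light vertex can always be deleted from the larger side. The two sizes vary
  independently, so the induction is on their sum.\<close>

lemma card_intersecting_pairs:
  assumes "pseudo_discs A" "pseudo_discs B" "finite A" "finite B" "t \<ge> 1"
    and "\<And>X Y. \<lbrakk>X \<subseteq> A; Y \<subseteq> B; card X = t; card Y = t\<rbrakk> \<Longrightarrow> \<exists>x\<in>X. \<exists>y\<in>Y. x \<inter> y = {}"
  shows "card {(a, b). a \<in> A \<and> b \<in> B \<and> a \<inter> b \<noteq> {}} \<le> degree_bound t * (card A + card B)"
  using assms(1-4,6)
proof (induction "card A + card B" arbitrary: A B rule: less_induct)
  case less
  let ?E = "\<lambda>A B. {(a, b). a \<in> A \<and> b \<in> B \<and> a \<inter> b \<noteq> {}}"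
  have fin: "finite (?E A' B')" if "finite A'" "finite B'" for A' B' :: "complex set set"
    by (rule finite_subset[of _ "A' \<times> B'"]) (use that in auto)
  show ?case
  proof (cases "A = {} \<or> B = {}")
    case True
    then show ?thesis by auto
  next
    case False
    show ?thesis
    proof (cases "card A \<le> card B")
      case True
      have "A \<noteq> {}"
        using False by simp
      then have "\<exists>b\<in>B. card {a \<in> A. a \<inter> b \<noteq> {}} \<le> degree_bound t"
        using True \<open>t \<ge> 1\<close> less.prems(5) by (rule light_member[OF less.prems(1-4)])
      then obtain b where b: "b \<in> B" "card {a \<in> A. a \<inter> b \<noteq> {}} \<le> degree_bound t" ..
      have card: "card B = Suc (card (B - {b}))"
        by (rule card_Suc_Diff1[OF less.prems(4) b(1), symmetric])
      have IH: "card (?E A (B - {b})) \<le> degree_bound t * (card A + card (B - {b}))"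
      proof (rule less.hyps)
        show "card A + card (B - {b}) < card A + card B"
          using card by simp
        show "pseudo_discs (B - {b})"
          using less.prems(2) by (rule pseudo_discs_subset) auto
        show "\<exists>x\<in>X. \<exists>y\<in>Y. x \<inter> y = {}" if "X \<subseteq> A" "Y \<subseteq> B - {b}" "card X = t" "card Y = t" for X Y
          using that by (intro less.prems(5)) auto
      qed (simp_all add: less.prems(1-4))
      have "?E A B \<subseteq> ?E A (B - {b}) \<union> (\<lambda>a. (a, b)) ` {a \<in> A. a \<inter> b \<noteq> {}}"
        by auto
      then have "card (?E A B) \<le> card (?E A (B - {b}) \<union> (\<lambda>a. (a, b)) ` {a \<in> A. a \<inter> b \<noteq> {}})"
        by (rule card_mono[rotated]) (intro finite_UnI finite_imageI fin; simp add: less.prems(3,4))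
      also have "\<dots> \<le> card (?E A (B - {b})) + card {a \<in> A. a \<inter> b \<noteq> {}}"
        using less.prems(3) by (intro order_trans[OF card_Un_le] add_mono card_image_le) auto
      also have "\<dots> \<le> degree_bound t * (card A + card (B - {b})) + degree_bound t"
        using IH b(2) by (rule add_mono)
      finally show ?thesis
        by (simp add: card)
    next
      case card_le: False
      have swapped: "\<exists>x\<in>X. \<exists>y\<in>Y. x \<inter> y = {}" if "X \<subseteq> B" "Y \<subseteq> A" "card X = t" "card Y = t" for X Y
      proof -
        have "\<exists>y\<in>Y. \<exists>x\<in>X. y \<inter> x = {}"
          using that by (intro less.prems(5)) auto
        then show ?thesis by (metis Int_commute)
      qed
      have "B \<noteq> {}" "card B \<le> card A"
        using False card_le by simp_all
      then have "\<exists>a\<in>A. card {b \<in> B. b \<inter> a \<noteq> {}} \<le> degree_bound t"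
        using \<open>t \<ge> 1\<close> swapped by (rule light_member[OF less.prems(2,1,4,3)])
      then obtain a where a: "a \<in> A" "card {b \<in> B. b \<inter> a \<noteq> {}} \<le> degree_bound t" ..
      have card: "card A = Suc (card (A - {a}))"
        by (rule card_Suc_Diff1[OF less.prems(3) a(1), symmetric])
      have IH: "card (?E (A - {a}) B) \<le> degree_bound t * (card (A - {a}) + card B)"
      proof (rule less.hyps)
        show "card (A - {a}) + card B < card A + card B"
          using card by simp
        show "pseudo_discs (A - {a})"
          using less.prems(1) by (rule pseudo_discs_subset) auto
        show "\<exists>x\<in>X. \<exists>y\<in>Y. x \<inter> y = {}" if "X \<subseteq> A - {a}" "Y \<subseteq> B" "card X = t" "card Y = t" for X Y
          using that by (intro less.prems(5)) auto
      qed (simp_all add: less.prems(1-4))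
      have "?E A B \<subseteq> ?E (A - {a}) B \<union> Pair a ` {b \<in> B. b \<inter> a \<noteq> {}}"
        by auto
      then have "card (?E A B) \<le> card (?E (A - {a}) B \<union> Pair a ` {b \<in> B. b \<inter> a \<noteq> {}})"
        by (rule card_mono[rotated]) (intro finite_UnI finite_imageI fin; simp add: less.prems(3,4))
      also have "\<dots> \<le> card (?E (A - {a}) B) + card {b \<in> B. b \<inter> a \<noteq> {}}"
        using less.prems(4) by (intro order_trans[OF card_Un_le] add_mono card_image_le) auto
      also have "\<dots> \<le> degree_bound t * (card (A - {a}) + card B) + degree_bound t"
        using IH a(2) by (rule add_mono)
      finally show ?thesis
        by (simp add: card)
    qed
  qed
qed

text \<open>Here \<open>262144 = 4 * 2 ^ 10 * 64\<close>, and the summand 2 is absorbed as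
  \<open>2 * t\<close>.\<close>

lemma degree_bound_le:
  assumes "t \<ge> 1"
  shows "real (degree_bound t) \<le> 64 * 262146 ^ 4 * real t ^ 6"
proof -
  have "real (degree_bound t) = 64 * real t ^ 2 * (262144 * real t + 2) ^ 4"
    by (simp add: degree_bound_def power2_eq_square add.commute)
  also have "\<dots> \<le> 64 * real t ^ 2 * (262146 * real t) ^ 4"
    using assms by (intro mult_left_mono power_mono) auto
  also have "\<dots> = 64 * 262146 ^ 4 * (real t ^ 2 * real t ^ 4)"
    by (simp only: power_mult_distrib mult_ac)
  also have "real t ^ 2 * real t ^ 4 = real t ^ 6"
    by (simp flip: power_add)
  finally show ?thesis .
qed

theorem theorem4:
  "\<exists>C::real. C > 0 \<and>
     (\<forall>(t::nat) (n::nat) (A::complex set set) (B::complex set set).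
        t \<ge> 2 \<longrightarrow>
        pseudo_discs A \<longrightarrow> pseudo_discs B \<longrightarrow>
        finite A \<longrightarrow> finite B \<longrightarrow> card A = n \<longrightarrow> card B = n \<longrightarrow>
        biclique_free t (intersection_edges A B) \<longrightarrow>
        real (card (intersection_edges A B)) \<le> C * real t ^ 6 * real n)"
proof (intro exI conjI allI impI)
  \<comment> \<open>The leading 2 is there because the two sides have \<open>2 * n\<close> vertices
    together.\<close>
  show "(0::real) < 2 * (64 * 262146 ^ 4)"
    by simp
  fix t n :: nat and A B :: "complex set set"
  assume t: "t \<ge> 2" and AB: "pseudo_discs A" "pseudo_discs B" "finite A" "finite B"
    and n: "card A = n" "card B = n" and free: "biclique_free t (intersection_edges A B)"
  have "\<exists>x\<in>X. \<exists>y\<in>Y. x \<inter> y = {}" if XY: "X \<subseteq> A" "Y \<subseteq> B" "card X = t" "card Y = t" for X Y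
  proof (rule ccontr)
    assume no: "\<not> ?thesis"
    have "finite X" "finite Y"
      using XY t by (auto intro: card_ge_0_finite)
    moreover have "card (Inl ` X :: (complex set + complex set) set) = t"
        "card (Inr ` Y :: (complex set + complex set) set) = t"
      using XY by (simp_all add: card_image)
    moreover have "{x, y} \<in> intersection_edges A B" if xy: "x \<in> Inl ` X" "y \<in> Inr ` Y" for x y
    proof -
      obtain a b where ab: "x = Inl a" "y = Inr b" "a \<in> X" "b \<in> Y"
        using xy by auto
      then have "a \<in> A" "b \<in> B" "a \<inter> b \<noteq> {}"
        using XY no by auto
      then show ?thesis
        using ab unfolding intersection_edges_def by auto
    qed
    moreover have "(Inl ` X :: (complex set + complex set) set) \<inter> Inr ` Y = {}"
      by auto
    ultimately show False
      using free unfolding biclique_free_def by (metis finite_imageI)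
  qed
  then have "card {(a, b). a \<in> A \<and> b \<in> B \<and> a \<inter> b \<noteq> {}} \<le> degree_bound t * (card A + card B)"
    using AB t by (intro card_intersecting_pairs) auto
  moreover have "card (intersection_edges A B) \<le> card {(a, b). a \<in> A \<and> b \<in> B \<and> a \<inter> b \<noteq> {}}"
  proof -
    have "intersection_edges A B = (\<lambda>(a, b). {Inl a, Inr b}) ` {(a, b). a \<in> A \<and> b \<in> B \<and> a \<inter> b \<noteq> {}}"
      unfolding intersection_edges_def by auto
    moreover have "finite {(a, b). a \<in> A \<and> b \<in> B \<and> a \<inter> b \<noteq> {}}"
      by (rule finite_subset[of _ "A \<times> B"]) (use AB in auto)
    ultimately show ?thesis
      by (simp add: card_image_le)
  qed
  ultimately have "card (intersection_edges A B) \<le> degree_bound t * (2 * n)"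
    using n by (simp add: mult_2)
  then have "real (card (intersection_edges A B)) \<le> real (degree_bound t * (2 * n))"
    by (simp only: of_nat_le_iff)
  also have "\<dots> = real (degree_bound t) * (2 * real n)"
    by simp
  also have "\<dots> \<le> (64 * 262146 ^ 4 * real t ^ 6) * (2 * real n)"
    using t by (intro mult_right_mono degree_bound_le) auto
  finally show "real (card (intersection_edges A B)) \<le> 2 * (64 * 262146 ^ 4) * real t ^ 6 * real n"
    by (simp add: mult_ac)
qed

end
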